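(* Let $d\ge2$ and $m\ge d-1$ be integers, let $p_0,\dots,p_m>0$ with $\sum_j p_j=1$, and let $\mu$ be the self-similar probability measure satisfying $\mu=\sum_{j=0}^m p_j\,\mu\circ S_j^{-1}$, where $S_j(x)=\frac1d x+\frac{j}{md}(d-1)$ for $j=0,\dots,m$. Let $\mu^k$ be the $k$-fold convolution of $\mu$, normalized to $[0,1]$. Then, as $k\to\infty$, $$\dim_{loc}\mu^k(x)\to 1\ \text{ for all } x\in(0,1)\qquad\text{and}\qquad \dim_{loc}\mu^k(x)\to\infty\ \text{ for } x=0,1.$$
   Context: For a probability measure $\nu$ and $x\in\operatorname{supp}\nu$, the local dimension of $\nu$ at $x$ is $\dim_{loc}\nu(x)=\lim_{r\to0^+}\frac{\log\nu([x-r,x+r])}{\log r}$ when the limit exists. "Normalized to $[0,1]$" means that $\mu*\cdots*\mu$ ($k$ factors), which is supported on $[0,k]$, is rescaled by $x\mapsto x/k$. *)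

theory Defs
  imports "HOL-Probability.Probability"
begin

definition contr :: "nat \<Rightarrow> nat \<Rightarrow> nat \<Rightarrow> real \<Rightarrow> real" where
  "contr d m j x = x / real d + real j / (real m * real d) * (real d - 1)"

definition self_similar :: "nat \<Rightarrow> nat \<Rightarrow> (nat \<Rightarrow> real) \<Rightarrow> real measure \<Rightarrow> bool" where
  "self_similar d m p \<mu> \<longleftrightarrow>
     (\<forall>A\<in>sets borel. measure \<mu> A = (\<Sum>j\<le>m. p j * measure \<mu> (contr d m j -` A)))"

primrec conv_power :: "real measure \<Rightarrow> nat \<Rightarrow> real measure" where
  "conv_power \<mu> 0 = return borel 0"
| "conv_power \<mu> (Suc k) = convolution \<mu> (conv_power \<mu> k)"

definition normalized_conv_power :: "real measure \<Rightarrow> nat \<Rightarrow> real measure" where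
  "normalized_conv_power \<mu> k = distr (conv_power \<mu> k) borel (\<lambda>x. x / real k)"

text \<open>Since \<open>ln 0 = 0\<close>, the following quotient is meaningful only for \<open>x\<close> in the support of \<open>\<nu>\<close>.\<close>

definition log_ratio :: "real measure \<Rightarrow> real \<Rightarrow> real \<Rightarrow> ereal" where
  "log_ratio \<nu> x r = ereal (ln (measure \<nu> {x - r..x + r}) / ln r)"

definition has_local_dim :: "real measure \<Rightarrow> real \<Rightarrow> ereal \<Rightarrow> bool" where
  "has_local_dim \<nu> x D \<longleftrightarrow> (log_ratio \<nu> x \<longlongrightarrow> D) (at_right 0)"

definition lower_local_dim :: "real measure \<Rightarrow> real \<Rightarrow> ereal" where
  "lower_local_dim \<nu> x = Liminf (at_right 0) (log_ratio \<nu> x)"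

definition upper_local_dim :: "real measure \<Rightarrow> real \<Rightarrow> ereal" where
  "upper_local_dim \<nu> x = Limsup (at_right 0) (log_ratio \<nu> x)"

lemma has_local_dim_iff:
  "has_local_dim \<nu> x D \<longleftrightarrow> lower_local_dim \<nu> x = D \<and> upper_local_dim \<nu> x = D"
  unfolding has_local_dim_def lower_local_dim_def upper_local_dim_def
  by (metis Liminf_eq_Limsup lim_imp_Liminf lim_imp_Limsup trivial_limit_at_right_real)

text \<open>A limit of local dimensions is read through lower and upper local dimensions, because
  the local dimension need not exist at every point. Where it exists for (cofinally many) \<open>k\<close>,
  it has the same limit.\<close>

definition local_dims_tendsto :: "(nat \<Rightarrow> real measure) \<Rightarrow> real \<Rightarrow> ereal \<Rightarrow> bool" where
  "local_dims_tendsto \<nu> x L \<longleftrightarrow>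
     (\<lambda>k. lower_local_dim (\<nu> k) x) \<longlonglongrightarrow> L \<and> (\<lambda>k. upper_local_dim (\<nu> k) x) \<longlonglongrightarrow> L"

lemma local_dims_tendstoD:
  assumes "local_dims_tendsto \<nu> x L" and "open U" and "L \<in> U"
  shows "\<forall>\<^sub>F k in sequentially. \<forall>D. has_local_dim (\<nu> k) x D \<longrightarrow> D \<in> U"
proof -
  have "\<forall>\<^sub>F k in sequentially. lower_local_dim (\<nu> k) x \<in> U"
    using assms by (auto simp: local_dims_tendsto_def tendsto_def)
  then show ?thesis
    by eventually_elim (auto simp: has_local_dim_iff)
qed

end

theory Submission
  imports Defs
begin

text \<open>The measure \<open>\<mu>\<^sup>k\<close> is again self-similar with ratio \<open>1/d\<close>, with \<open>k m\<close> in place of \<open>m\<close> and the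
  \<open>k\<close>-fold convolution \<open>q\<close> of the weights in place of \<open>p\<close>. So up to constants the mass of an
  interval of radius \<open>d^-n\<close> is a point probability of \<open>\<Sum>i<n. d^i b\<^sub>i\<close> with \<open>b\<^sub>i\<close> independent of
  law \<open>q\<close>. Such a probability is at most \<open>\<sigma>^n\<close>, where \<open>\<sigma>\<close> is the largest mass that \<open>q\<close> gives to
  a residue class modulo \<open>d\<close>. At interior points it is at least a constant times \<open>\<rho>^n\<close>, where \<open>\<rho>\<close>
  is the smallest mass of a residue class among the digits close to the mean. As \<open>k\<close> grows, \<open>q\<close>
  equidistributes modulo \<open>d\<close> and concentrates at its mean, so \<open>\<sigma>\<close> and \<open>\<rho>\<close> tend to \<open>1/d\<close>. At the
  endpoints only one digit string contributes, and the dimension is exactly linear in \<open>k\<close>.\<close>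

section \<open>Sums of independent digits\<close>

text \<open>The law of \<open>\<Sum>i<n. d^i b\<^sub>i\<close> with \<open>b\<^sub>i\<close> independent of law \<open>q\<close>; for \<open>d = 1\<close> it is the \<open>n\<close>-fold
  convolution of \<open>q\<close>.\<close>


fun digit_sum :: "nat \<Rightarrow> nat pmf \<Rightarrow> nat \<Rightarrow> nat pmf" where
  "digit_sum d q 0 = return_pmf 0"
| "digit_sum d q (Suc n) = bind_pmf q (\<lambda>b. map_pmf (\<lambda>u. d * u + b) (digit_sum d q n))"

section \<open>Support and point probabilities of digit sums\<close>

lemma finite_digit_sum [simp]: "finite (set_pmf q) \<Longrightarrow> finite (set_pmf (digit_sum d q n))"
  by (induction n) auto

lemma integral_pmf_cong:
  fixes f g :: "'a \<Rightarrow> real"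
  assumes "\<And>x. x \<in> set_pmf p \<Longrightarrow> f x = g x"
  shows "(\<integral>x. f x \<partial>p) = (\<integral>x. g x \<partial>p)"
  using assms by (intro integral_cong_AE) (auto simp: AE_measure_pmf_iff)

lemma pmf_map_affine:
  fixes d b v :: nat
  assumes "d > 0"
  shows "pmf (map_pmf (\<lambda>u. d * u + b) N) v =
    (if b \<le> v \<and> v mod d = b mod d then pmf N ((v - b) div d) else 0)"
proof (cases "b \<le> v \<and> v mod d = b mod d")
  case True
  then have "d dvd v - b" using mod_eq_dvd_iff_nat[of b v d] by simp
  then obtain w where "v - b = d * w" by blast
  then have w: "v = d * w + b" using True by linarith
  have "inj (\<lambda>u. d * u + b)" using assms by (auto simp: inj_on_def)
  from pmf_map_inj'[OF this, of N w] show ?thesis using assms w by simp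
next
  case False
  then have "v \<notin> (\<lambda>u. d * u + b) ` set_pmf N" by auto
  then show ?thesis using False by (auto simp: pmf_map_outside)
qed

lemma pmf_digit_sum_Suc:
  assumes "d > 0"
  shows "pmf (digit_sum d q (Suc n)) v =
    (\<integral>b. (if b \<le> v \<and> v mod d = b mod d then pmf (digit_sum d q n) ((v - b) div d) else 0) \<partial>q)"
  by (simp add: pmf_bind pmf_map_affine[OF assms])

text \<open>The lowest digit is confined to the residue class of \<open>v\<close>, of mass at most
  \<open>\<sigma>\<close>; once it is fixed, the other digits must produce one prescribed number. So
  every level costs a factor \<open>\<sigma>\<close>.\<close>

lemma pmf_digit_sum_upper:
  assumes "d > 0" and fin: "finite (set_pmf q)"
    and \<sigma>: "\<And>c. measure q {b. b mod d = c mod d} \<le> \<sigma>"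
  shows "pmf (digit_sum d q n) v \<le> \<sigma> ^ n"
proof (induction n arbitrary: v)
  case 0
  show ?case by (simp add: pmf_le_1)
next
  case (Suc n)
  have "\<sigma> \<ge> 0" using \<sigma>[of 0] measure_nonneg order_trans by blast
  have "pmf (digit_sum d q (Suc n)) v \<le> (\<integral>b. indicator {b. b mod d = v mod d} b * \<sigma> ^ n \<partial>q)"
    unfolding pmf_digit_sum_Suc[OF assms(1)] using Suc.IH \<open>\<sigma> \<ge> 0\<close>
    by (intro integral_mono integrable_measure_pmf_finite[OF fin]) (auto simp: indicator_def)
  also have "\<dots> = measure q {b. b mod d = v mod d} * \<sigma> ^ n"
    by simp
  also have "\<dots> \<le> \<sigma> ^ Suc n" using \<sigma>[of v] \<open>\<sigma> \<ge> 0\<close> by (simp add: mult_right_mono)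
  finally show ?case .
qed

lemma repunit_Suc: "M * (\<Sum>i<Suc n. d ^ i) = M + d * (M * (\<Sum>i<n. d ^ i))" for d M :: nat
  by (simp only: sum.lessThan_Suc_shift) (simp add: sum_distrib_left algebra_simps)

lemma set_digit_sum_le:
  assumes "set_pmf q \<subseteq> {..M}" "u \<in> set_pmf (digit_sum d q n)"
  shows "u \<le> M * (\<Sum>i<n. d ^ i)"
  using assms(2)
proof (induction n arbitrary: u)
  case (Suc n)
  then obtain b v where "b \<in> set_pmf q" "v \<in> set_pmf (digit_sum d q n)" "u = d * v + b"
    by auto
  moreover have "d * v \<le> d * (M * (\<Sum>i<n. d ^ i))" using Suc.IH calculation by simp
  moreover have "b \<le> M" using assms(1) calculation by auto
  ultimately show ?case unfolding repunit_Suc by linarith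
qed auto

text \<open>As \<open>d - 1 \<le> M\<close>, the blocks \<open>d * v + {0..M}\<close> for
  consecutive \<open>v\<close> leave no gap. This makes all point probabilities at a fixed level
  positive.\<close>

lemma set_digit_sum:
  assumes "set_pmf q = {..M}" "d - 1 \<le> M" "d > 0"
  shows "set_pmf (digit_sum d q n) = {..M * (\<Sum>i<n. d ^ i)}"
proof (intro equalityI subsetI)
  fix u assume "u \<in> set_pmf (digit_sum d q n)"
  then show "u \<in> {..M * (\<Sum>i<n. d ^ i)}" using set_digit_sum_le[of q M u d n] assms(1) by auto
next
  fix u assume "u \<in> {..M * (\<Sum>i<n. d ^ i)}"
  then show "u \<in> set_pmf (digit_sum d q n)"
  proof (induction n arbitrary: u)
    case (Suc n)
    define G where "G = M * (\<Sum>i<n. d ^ i)"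
    have u: "u \<le> M + d * G" using Suc.prems unfolding repunit_Suc by (simp add: G_def)
    have "\<exists>b v. b \<le> M \<and> v \<le> G \<and> u = d * v + b"
    proof (cases "u \<le> M")
      case False
      \<comment> \<open>\<open>v\<close> is \<open>(u - M) / d\<close> rounded up, the smallest
        value for which the leftover \<open>u - d * v\<close> is at most \<open>M\<close>.\<close>
      define v where "v = (u - M + (d - 1)) div d"
      have "d * v \<le> u - M + (d - 1)" unfolding v_def by simp
      moreover have "u - M + (d - 1) < d * v + d"
        unfolding v_def using dividend_less_times_div[OF assms(3), of "u - M + (d - 1)"] by linarith
      ultimately have 1: "d * v \<le> u" "u \<le> M + d * v" using False assms(2,3) by linarith+
      have "d * v < d * Suc G" using \<open>d * v \<le> u - M + (d - 1)\<close> u assms(3) False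
        unfolding mult_Suc_right by linarith
      then have "v < Suc G" by (simp only: mult_less_cancel1)
      then have "v \<le> G" by simp
      then show ?thesis using 1 by (intro exI[of _ "u - d * v"] exI[of _ v]) auto
    next
      case True
      then have "u \<le> M \<and> 0 \<le> G \<and> u = d * 0 + u" by simp
      then show ?thesis by blast
    qed
    then obtain b v where "b \<le> M" "v \<le> G" "u = d * v + b" by blast
    then show ?case using Suc.IH[of v] assms(1) by (auto simp: G_def)
  qed auto
qed

lemma pmf_digit_sum_0:
  assumes "d > 0"
  shows "pmf (digit_sum d q n) 0 = pmf q 0 ^ n"
proof (induction n)
  case (Suc n)
  have "pmf (digit_sum d q (Suc n)) 0 = (\<integral>b. indicator {0} b * pmf q 0 ^ n \<partial>q)"
    unfolding pmf_digit_sum_Suc[OF assms]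
    by (intro Bochner_Integration.integral_cong) (auto simp: indicator_def Suc)
  then show ?case by (simp add: measure_pmf_single)
qed simp

text \<open>Only the string with all digits equal to \<open>M\<close> reaches the maximum.\<close>

lemma pmf_digit_sum_top:
  assumes "d > 0" "set_pmf q \<subseteq> {..M}"
  shows "pmf (digit_sum d q n) (M * (\<Sum>i<n. d ^ i)) = pmf q M ^ n"
proof (induction n)
  case (Suc n)
  define G where "G = M * (\<Sum>i<n. d ^ i)"
  have G: "M * (\<Sum>i<Suc n. d ^ i) = M + d * G"
    unfolding repunit_Suc G_def ..
  have "pmf (digit_sum d q (Suc n)) (M + d * G) = (\<integral>b. indicator {M} b * pmf q M ^ n \<partial>q)"
    unfolding pmf_digit_sum_Suc[OF assms(1)]
  proof (rule integral_pmf_cong)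
    fix b assume "b \<in> set_pmf q"
    then have "b \<le> M" using assms(2) by auto
    show "(if b \<le> M + d * G \<and> (M + d * G) mod d = b mod d
            then pmf (digit_sum d q n) ((M + d * G - b) div d) else 0) = indicator {M} b * pmf q M ^ n"
    proof (cases "b = M")
      case True
      then show ?thesis using assms(1) Suc by (simp add: G_def)
    next
      case False
      then have "b < M" using \<open>b \<le> M\<close> by simp
      \<comment> \<open>A lowest digit below \<open>M\<close> leaves a remainder
        \<open>w > G\<close>, beyond the largest value of the other digits.\<close>
      have "pmf (digit_sum d q n) ((M + d * G - b) div d) = 0" if "(M + d * G) mod d = b mod d"
      proof -
        have "d dvd M + d * G - b" using that \<open>b \<le> M\<close> mod_eq_dvd_iff_nat[of b "M + d * G" d] by simp
        then obtain w where w: "M + d * G - b = d * w" by blast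
        then have "d * w > d * G" using \<open>b < M\<close> by linarith
        then have "w > G" by simp
        then have "w \<notin> set_pmf (digit_sum d q n)"
          using set_digit_sum_le[OF assms(2), of w d n] by (auto simp: G_def)
        then show ?thesis using w assms(1) by (simp add: set_pmf_iff)
      qed
      then show ?thesis using False by simp
    qed
  qed
  then show ?case unfolding G by (simp add: measure_pmf_single del: digit_sum.simps)
qed simp

section \<open>Equidistribution modulo \<open>d\<close>\<close>

lemma measure_digit_sum_Suc:
  assumes "finite (set_pmf q)"
  shows "measure (digit_sum d q (Suc n)) A = (\<integral>b. measure (digit_sum d q n) {u. d * u + b \<in> A} \<partial>q)"
proof -
  have "ennreal (measure (digit_sum d q (Suc n)) A)
      = (\<integral>\<^sup>+b. ennreal (measure (digit_sum d q n) {u. d * u + b \<in> A}) \<partial>q)"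
    by (simp add: measure_pmf.emeasure_eq_measure[symmetric] vimage_def)
  also have "\<dots> = ennreal (\<integral>b. measure (digit_sum d q n) {u. d * u + b \<in> A} \<partial>q)"
    by (intro nn_integral_eq_integral integrable_measure_pmf_finite assms) auto
  finally show ?thesis by (simp add: integral_nonneg)
qed

text \<open>For each \<open>b\<close> exactly one shift \<open>j < d\<close> makes
  \<open>b + (c + j)\<close> divisible by \<open>d\<close>, so the events partition the
  space.\<close>

lemma sum_shift_mod_measure:
  fixes N :: "nat pmf"
  assumes "d > 0"
  shows "(\<Sum>j<d. measure N {b. d dvd b + (c + j)}) = 1"
proof -
  have "(\<Sum>j<d. measure N {b. d dvd b + (c + j)}) = measure N (\<Union>j<d. {b. d dvd b + (c + j)})"
  proof (rule measure_pmf.finite_measure_finite_Union[symmetric])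
    show "disjoint_family_on (\<lambda>j. {b. d dvd b + (c + j)}) {..<d}"
    proof (unfold disjoint_family_on_def, intro ballI impI equals0I)
      fix i j b assume *: "i \<in> {..<d}" "j \<in> {..<d}" "i \<noteq> j"
        "b \<in> {b. d dvd b + (c + i)} \<inter> {b. d dvd b + (c + j)}"
      then have dvd: "d dvd b + (c + i)" "d dvd b + (c + j)" by auto
      have "d dvd j - i" "d dvd i - j"
        using dvd_diff_nat[OF dvd(2,1)] dvd_diff_nat[OF dvd] by simp_all
      then show False using * nat_dvd_not_less[of "j - i" d] nat_dvd_not_less[of "i - j" d]
        by (cases "i < j") (auto dest: less_imp_diff_less)
    qed
  qed auto
  also have "(\<Union>j<d. {b. d dvd b + (c + j)}) = UNIV"
  proof (intro equalityI subsetI UNIV_I)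
    fix b :: nat
    \<comment> \<open>The outer \<open>mod d\<close> turns the value \<open>d\<close> into 0 when
      \<open>b + c\<close> is already divisible.\<close>
    define j where "j = (d - (b + c) mod d) mod d"
    have "j < d" using assms by (simp add: j_def)
    moreover have "d dvd (b + c) + j"
      unfolding j_def by (metis assms dvd_eq_mod_eq_0 le_add_diff_inverse mod_add_left_eq mod_add_right_eq mod_less_divisor mod_self order_less_imp_le)
    ultimately show "b \<in> (\<Union>j<d. {b. d dvd b + (c + j)})" by (auto simp: add.assoc)
  qed
  finally show ?thesis by simp
qed

text \<open>The deviations from \<open>1/d\<close> sum to zero over a complete residue system, so lowering the weights of
  the digits below \<open>d\<close> by \<open>\<eta>\<close> does not change the recursion; the remaining mass is \<open>1 - d \<eta>\<close>.\<close>

lemma residue_equidistribution: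
  assumes "d > 0" "finite (set_pmf P)" and \<eta>: "\<And>j. j < d \<Longrightarrow> \<eta> \<le> pmf P j"
  shows "\<bar>measure (digit_sum 1 P k) {b. d dvd b + c} - 1 / real d\<bar> \<le> (1 - real d * \<eta>) ^ k"
proof (induction k arbitrary: c)
  case 0
  show ?case using assms(1) by (simp add: indicator_def measure_return_pmf)
next
  case (Suc k)
  define e where "e c = measure (digit_sum 1 P k) {b. d dvd b + c} - 1 / real d" for c
  define S where "S = set_pmf P \<union> {..<d}"
  have S: "finite S" "{..<d} \<subseteq> S" unfolding S_def using assms by auto
  have sumP: "(\<Sum>j\<in>S. pmf P j) = 1" using S by (intro sum_pmf_eq_1) (auto simp: S_def)
  have e0: "(\<Sum>j<d. e (c + j)) = 0"
    using sum_shift_mod_measure[OF assms(1), of "digit_sum 1 P k" c] assms(1)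
    unfolding e_def by (simp add: sum_subtractf)
  have "measure (digit_sum 1 P (Suc k)) {b. d dvd b + c} = (\<Sum>j\<in>S. (e (c + j) + 1 / real d) * pmf P j)"
    unfolding measure_digit_sum_Suc[OF assms(2)] e_def
    using S by (subst integral_measure_pmf_real[of S]) (auto simp: S_def add_ac)
  also have "\<dots> = (\<Sum>j\<in>S. e (c + j) * pmf P j) + 1 / real d"
    using sumP by (simp add: distrib_right sum.distrib flip: sum_distrib_left sum_divide_distrib)
  also have "(\<Sum>j\<in>S. e (c + j) * pmf P j)
      = (\<Sum>j\<in>S. e (c + j) * pmf P j) - \<eta> * (\<Sum>j<d. e (c + j))" using e0 by simp
  also have "(\<Sum>j<d. e (c + j)) = (\<Sum>j\<in>S. e (c + j) * of_bool (j < d))"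
    using S by (intro sum.mono_neutral_cong_left) auto
  also have "(\<Sum>j\<in>S. e (c + j) * pmf P j) - \<eta> * \<dots> = (\<Sum>j\<in>S. e (c + j) * (pmf P j - \<eta> * of_bool (j < d)))"
    by (simp add: sum_distrib_left algebra_simps flip: sum_subtractf)
  finally have "\<bar>measure (digit_sum 1 P (Suc k)) {b. d dvd b + c} - 1 / real d\<bar>
      = \<bar>\<Sum>j\<in>S. e (c + j) * (pmf P j - \<eta> * of_bool (j < d))\<bar>" by simp
  \<comment> \<open>The lowered weights are nonnegative by the hypothesis on \<open>\<eta>\<close>,
    so absolute values fall on \<open>e\<close> only.\<close>
  also have "\<dots> \<le> (\<Sum>j\<in>S. \<bar>e (c + j)\<bar> * (pmf P j - \<eta> * of_bool (j < d)))"
    using \<eta> by (intro order_trans[OF sum_abs] sum_mono) (auto simp: abs_mult of_bool_def)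
  also have "\<dots> \<le> (\<Sum>j\<in>S. (1 - real d * \<eta>) ^ k * (pmf P j - \<eta> * of_bool (j < d)))"
    using \<eta> Suc.IH by (intro sum_mono mult_right_mono) (auto simp: e_def of_bool_def)
  also have "\<dots> = (1 - real d * \<eta>) ^ k * (\<Sum>j\<in>S. pmf P j - \<eta> * of_bool (j < d))"
    by (simp add: sum_distrib_left)
  also have "(\<Sum>j\<in>S. pmf P j - \<eta> * of_bool (j < d)) = 1 - \<eta> * (\<Sum>j\<in>S. of_bool (j < d))"
    using sumP by (simp add: sum_subtractf sum_distrib_left)
  also have "(\<Sum>j\<in>S. of_bool (j < d)) = (\<Sum>j<d. (1::real))"
    using S by (intro sum.mono_neutral_cong_right) auto
  finally show ?case by (simp add: mult_ac)
qed

text \<open>\<open>f\<close> may be unbounded, but it is bounded on the finite support. Setting it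
  to 0 where it exceeds its maximum there gives a bounded \<open>h\<close>, to which the exchange of
  integrals applies.\<close>

lemma integral_bind_pmf_finite:
  fixes f :: "'b \<Rightarrow> real"
  assumes "finite (set_pmf p)" "\<And>x. x \<in> set_pmf p \<Longrightarrow> finite (set_pmf (g x))"
  shows "(\<integral>y. f y \<partial>bind_pmf p g) = (\<integral>x. (\<integral>y. f y \<partial>g x) \<partial>p)"
proof -
  define B where "B = Max (insert 0 ((\<lambda>y. \<bar>f y\<bar>) ` set_pmf (bind_pmf p g)))"
  have "finite (set_pmf (bind_pmf p g))" using assms by simp
  then have B: "\<bar>f y\<bar> \<le> B" if "y \<in> set_pmf (bind_pmf p g)" for y
    unfolding B_def using that by (intro Max_ge) auto
  define h where "h y = (if \<bar>f y\<bar> \<le> B then f y else 0)" for y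
  have "B \<ge> 0" unfolding B_def using \<open>finite (set_pmf (bind_pmf p g))\<close> by (intro Max_ge) auto
  have "(\<integral>y. f y \<partial>bind_pmf p g) = (\<integral>y. h y \<partial>bind_pmf p g)"
    using B by (intro integral_pmf_cong) (simp add: h_def)
  also have "\<dots> = (\<integral>x. (\<integral>y. h y \<partial>g x) \<partial>p)"
    unfolding measure_pmf_bind
    by (rule integral_bind[where K = "count_space UNIV" and B = B and B' = 1])
      (use \<open>B \<ge> 0\<close> in \<open>auto simp: h_def measure_pmf_in_subprob_space\<close>)
  also have "\<dots> = (\<integral>x. (\<integral>y. f y \<partial>g x) \<partial>p)"
    using B by (intro integral_pmf_cong) (auto simp: h_def)
  finally show ?thesis .
qed

text \<open>An independent digit adds its own variance, because the cross term vanishes when the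
  previous centred sum has mean zero. Hence both moments are proved in one induction.\<close>

lemma moments_digit_sum_1:
  fixes e :: real
  assumes fin: "finite (set_pmf P)" and e: "e = (\<integral>j. real j \<partial>P)"
  shows "(\<integral>b. (real b - real k * e) \<partial>digit_sum 1 P k) = 0"
    and "(\<integral>b. (real b - real k * e)\<^sup>2 \<partial>digit_sum 1 P k) = real k * (\<integral>j. (real j - e)\<^sup>2 \<partial>P)"
proof (induction k)
  case (Suc k)
  define C where "C b = real b - real k * e" for b
  have C: "(\<integral>b. C b \<partial>digit_sum 1 P k) = 0"
      "(\<integral>b. (C b)\<^sup>2 \<partial>digit_sum 1 P k) = real k * (\<integral>j. (real j - e)\<^sup>2 \<partial>P)"
    unfolding C_def by (rule Suc)+
  have step: "(\<integral>b. f (real b - real (Suc k) * e) \<partial>digit_sum 1 P (Suc k))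
      = (\<integral>j. (\<integral>b. f (C b + (real j - e)) \<partial>digit_sum 1 P k) \<partial>P)" for f :: "real \<Rightarrow> real"
    by (simp add: integral_bind_pmf_finite fin C_def algebra_simps)
  have "(\<integral>j. (real j - e) \<partial>P) = 0"
    by (subst Bochner_Integration.integral_diff) (simp_all add: integrable_measure_pmf_finite fin e)
  { case 1
    have "(\<integral>b. C b + (real j - e) \<partial>digit_sum 1 P k) = real j - e" for j
      by (subst Bochner_Integration.integral_add) (use C in \<open>auto simp: integrable_measure_pmf_finite fin\<close>)
    with step[of "\<lambda>x. x"] show ?case using \<open>(\<integral>j. (real j - e) \<partial>P) = 0\<close> by simp
  next
    case 2
    have "(\<integral>b. (C b + (real j - e))\<^sup>2 \<partial>digit_sum 1 P k)
        = real k * (\<integral>j. (real j - e)\<^sup>2 \<partial>P) + (real j - e)\<^sup>2" for j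
    proof -
      have "(\<integral>b. (C b + (real j - e))\<^sup>2 \<partial>digit_sum 1 P k)
        = (\<integral>b. (C b)\<^sup>2 + (2 * (real j - e) * C b + (real j - e)\<^sup>2) \<partial>digit_sum 1 P k)"
        by (intro Bochner_Integration.integral_cong refl) (simp add: power2_eq_square algebra_simps)
      also have "\<dots> = (\<integral>b. (C b)\<^sup>2 \<partial>digit_sum 1 P k)
          + ((\<integral>b. 2 * (real j - e) * C b \<partial>digit_sum 1 P k) + (real j - e)\<^sup>2)"
        by (simp add: Bochner_Integration.integral_add integrable_measure_pmf_finite fin)
      finally show ?thesis using C by simp
    qed
    with step[of "\<lambda>x. x\<^sup>2"] show ?case by (simp add: algebra_simps integrable_measure_pmf_finite fin)
  }
qed auto

lemma Chebyshev_digit_sum_1: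
  fixes e a :: real
  assumes fin: "finite (set_pmf P)" and e: "e = (\<integral>j. real j \<partial>P)" and "a > 0"
  shows "measure (digit_sum 1 P k) {b. a \<le> \<bar>real b - real k * e\<bar>} \<le> real k * (\<integral>j. (real j - e)\<^sup>2 \<partial>P) / a\<^sup>2"
proof -
  have "(\<integral>b. real b \<partial>digit_sum 1 P k) = real k * e"
    using moments_digit_sum_1(1)[OF fin e, of k]
    by (subst (asm) Bochner_Integration.integral_diff) (simp_all add: integrable_measure_pmf_finite fin)
  with measure_pmf.Chebyshev_inequality[of real "digit_sum 1 P k" a] \<open>a > 0\<close>
    moments_digit_sum_1(2)[OF fin e, of k]
  show ?thesis by (simp add: integrable_measure_pmf_finite fin)
qed


section \<open>Local dimensions from geometric bounds\<close>

text \<open>As \<open>ln r < 0\<close>, a lower bound on the mass bounds the quotient from above;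
  the constant contributes only \<open>ln c / ln r\<close>, which vanishes as \<open>r\<close> tends
  to 0.\<close>

lemma log_ratio_le:
  assumes "c > 0" "0 < r" "r < 1" "c * r powr a \<le> measure \<nu> {x - r..x + r}"
  shows "ln (measure \<nu> {x - r..x + r}) / ln r \<le> a + ln c / ln r"
proof -
  have "ln c + a * ln r = ln (c * r powr a)" using assms by (simp add: ln_mult ln_powr)
  also have "\<dots> \<le> ln (measure \<nu> {x - r..x + r})" using assms 
    by (intro ln_mono) auto
  finally have "ln (measure \<nu> {x - r..x + r}) / ln r \<le> (ln c + a * ln r) / ln r"
    using assms by (intro divide_right_mono_neg) auto
  then show ?thesis using assms by (simp add: add_divide_distrib)
qed

lemma log_ratio_ge:
  assumes "K > 0" "0 < r" "r < 1" "0 < measure \<nu> {x - r..x + r}" "measure \<nu> {x - r..x + r} \<le> K * r powr a"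
  shows "a + ln K / ln r \<le> ln (measure \<nu> {x - r..x + r}) / ln r"
proof -
  have "ln (measure \<nu> {x - r..x + r}) \<le> ln (K * r powr a)" using assms by (subst ln_le_cancel_iff) auto
  also have "\<dots> = ln K + a * ln r" using assms by (simp add: ln_mult ln_powr)
  finally have "(ln K + a * ln r) / ln r \<le> ln (measure \<nu> {x - r..x + r}) / ln r"
    using assms by (intro divide_right_mono_neg) auto
  then show ?thesis using assms by (simp add: add_divide_distrib)
qed

lemma tendsto_add_const_div_ln: "((\<lambda>r. ereal (a + c / ln r)) \<longlongrightarrow> ereal a) (at_right 0)"
proof -
  have "((\<lambda>r. a + c / ln r) \<longlongrightarrow> a + 0) (at_right (0::real))"
    by (intro tendsto_add tendsto_const tendsto_divide_0[OF tendsto_const] filterlim_at_bot_imp_at_infinity ln_at_0)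
  then show ?thesis by simp
qed

lemma upper_local_dim_le:
  assumes "c > 0" "R > 0" "\<And>r. 0 < r \<Longrightarrow> r < R \<Longrightarrow> c * r powr a \<le> measure \<nu> {x - r..x + r}"
  shows "upper_local_dim \<nu> x \<le> ereal a"
proof -
  have "\<forall>\<^sub>F r in at_right 0. log_ratio \<nu> x r \<le> ereal (a + ln c / ln r)"
    unfolding eventually_at_right_field log_ratio_def
    using assms log_ratio_le[OF assms(1)] by (intro exI[of _ "min 1 R"]) auto
  then have "upper_local_dim \<nu> x \<le> Limsup (at_right 0) (\<lambda>r. ereal (a + ln c / ln r))"
    unfolding upper_local_dim_def by (rule Limsup_mono)
  also have "\<dots> = ereal a"
    by (intro lim_imp_Limsup tendsto_add_const_div_ln) simp
  finally show ?thesis .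
qed

text \<open>Positivity is a separate hypothesis because of \<open>ln 0 = 0\<close>: a null interval
  satisfies every upper bound on its mass, yet gives quotient 0.\<close>

lemma lower_local_dim_ge:
  assumes "K > 0" "R > 0" "\<And>r. 0 < r \<Longrightarrow> r < R \<Longrightarrow> 0 < measure \<nu> {x - r..x + r}"
    "\<And>r. 0 < r \<Longrightarrow> r < R \<Longrightarrow> measure \<nu> {x - r..x + r} \<le> K * r powr a"
  shows "ereal a \<le> lower_local_dim \<nu> x"
proof -
  have "\<forall>\<^sub>F r in at_right 0. ereal (a + ln K / ln r) \<le> log_ratio \<nu> x r"
    unfolding eventually_at_right_field log_ratio_def
    using assms log_ratio_ge[OF assms(1)] by (intro exI[of _ "min 1 R"]) auto
  then have "Liminf (at_right 0) (\<lambda>r. ereal (a + ln K / ln r)) \<le> lower_local_dim \<nu> x"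
    unfolding lower_local_dim_def by (rule Liminf_mono)
  moreover have "Liminf (at_right 0) (\<lambda>r. ereal (a + ln K / ln r)) = ereal a"
    by (intro lim_imp_Liminf tendsto_add_const_div_ln) simp
  ultimately show ?thesis by simp
qed

lemma lower_le_upper_local_dim: "lower_local_dim \<nu> x \<le> upper_local_dim \<nu> x"
  unfolding lower_local_dim_def upper_local_dim_def by (intro Liminf_le_Limsup) simp

text \<open>Decay by a factor \<open>w\<close> per level becomes a power law in the scale
  \<open>d powr (-z)\<close>.\<close>

lemma powr_geometric:
  fixes d w z :: real
  assumes "d > 1" "0 < w"
  shows "w powr z = (d powr (-z)) powr (- ln w / ln d)"
  using assms by (simp add: powr_def)

text \<open>Passes from the scales \<open>e * (1 / d) ^ n\<close> to all radii: replacing a radius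
  by the next smaller scale costs at most one factor \<open>\<rho>\<close>, which only changes the
  constant.\<close>

lemma upper_local_dim_le_geometric:
  fixes d \<rho> c e :: real
  assumes "d > 1" "0 < \<rho>" "\<rho> \<le> 1" "c > 0" "e > 0"
    and *: "\<And>n r. N \<le> n \<Longrightarrow> e * (1 / d) ^ n \<le> r \<Longrightarrow> c * \<rho> ^ n \<le> measure \<nu> {x - r..x + r}"
  shows "upper_local_dim \<nu> x \<le> ereal (- ln \<rho> / ln d)"
proof -
  define a where "a = - ln \<rho> / ln d"
  have "a \<ge> 0" using assms by (simp add: a_def field_simps)
  have "c * \<rho> * (1 / e) powr a * r powr a \<le> measure \<nu> {x - r..x + r}"
    if r: "0 < r" "r < e * (1 / d) ^ N" for r
  proof -
    \<comment> \<open>\<open>z\<close> is the real level whose scale is exactly \<open>r\<close>.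
      Rounding up keeps the scale below \<open>r\<close>, and \<open>r < e * (1 / d) ^ N\<close>
      puts the level at \<open>N\<close> or above.\<close>
    define z where "z = log d (e / r)"
    define n where "n = nat \<lceil>z\<rceil>"
    have dz: "d powr z = e / r" using assms r by (simp add: z_def)
    have "d powr real N < d powr z"
      unfolding dz using r assms by (simp add: powr_realpow field_simps)
    then have "real N < z" using assms by simp
    then have n: "N \<le> n" "z \<le> real n" "real n \<le> z + 1" unfolding n_def by linarith+
    have "e / r \<le> d ^ n" using n assms dz
      by (metis (no_types, opaque_lifting) powr_mono powr_realpow less_imp_le order_less_trans zero_less_one)
    then have "e * (1 / d) ^ n \<le> r" using r assms by (simp add: field_simps)
    from *[OF n(1) this] have "c * \<rho> ^ n \<le> measure \<nu> {x - r..x + r}" .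
    moreover have "\<rho> * (1 / e) powr a * r powr a \<le> \<rho> ^ n"
    proof -
      have "\<rho> * (1 / e) powr a * r powr a = \<rho> * (r / e) powr a"
        using r assms by (simp add: powr_divide)
      also have "r / e = d powr (- z)" using dz by (simp add: powr_minus)
      also have "\<rho> * (d powr (- z)) powr a = \<rho> powr (z + 1)"
        unfolding a_def powr_geometric[OF assms(1,2), symmetric] using assms by (simp add: powr_add)
      also have "\<dots> \<le> \<rho> powr (real n)" using n assms by (intro powr_mono') auto
      finally show ?thesis using assms by (simp add: powr_realpow)
    qed
    ultimately show ?thesis using assms(4) by (simp add: mult.assoc) (meson mult_le_cancel_left_pos order_trans)
  qed
  then show ?thesis unfolding a_def[symmetric] using assms
    by (intro upper_local_dim_le[of "c * \<rho> * (1 / e) powr a" "e * (1 / d) ^ N"]) auto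
qed

lemma lower_local_dim_ge_geometric:
  fixes d \<sigma> K e :: real
  assumes "d > 1" "0 < \<sigma>" "\<sigma> \<le> 1" "K > 0" "e > 0" "R > 0"
    and pos: "\<And>r. 0 < r \<Longrightarrow> r < R \<Longrightarrow> 0 < measure \<nu> {x - r..x + r}"
    and *: "\<And>n r. r \<le> e * (1 / d) ^ n \<Longrightarrow> measure \<nu> {x - r..x + r} \<le> K * \<sigma> ^ n"
  shows "ereal (- ln \<sigma> / ln d) \<le> lower_local_dim \<nu> x"
proof -
  define a where "a = - ln \<sigma> / ln d"
  have "measure \<nu> {x - r..x + r} \<le> K / \<sigma> * (1 / e) powr a * r powr a"
    if r: "0 < r" "r < e" for r
  proof -
    define z where "z = log d (e / r)"
    \<comment> \<open>Rounding down now keeps \<open>r\<close> below the scale, at the price of a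
      factor \<open>1 / \<sigma>\<close>; \<open>r < e\<close> makes \<open>z\<close> positive, so
      \<open>nat\<close> does not truncate.\<close>
    define n where "n = nat \<lfloor>z\<rfloor>"
    have dz: "d powr z = e / r" using assms r by (simp add: z_def)
    have "d powr 0 < d powr z" unfolding dz using r assms by simp
    then have "0 < z" using assms by (simp only: powr_less_cancel_iff)
    then have n: "real n \<le> z" "z \<le> real n + 1" unfolding n_def by linarith+
    have "d ^ n \<le> e / r" using n assms dz
      by (metis (no_types, opaque_lifting) powr_mono powr_realpow less_imp_le order_less_trans zero_less_one)
    then have "r \<le> e * (1 / d) ^ n" using r assms by (simp add: field_simps)
    from *[OF this] have "measure \<nu> {x - r..x + r} \<le> K * \<sigma> ^ n" .
    also have "\<sigma> ^ n \<le> 1 / \<sigma> * ((1 / e) powr a * r powr a)"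
    proof -
      have "(1 / e) powr a * r powr a = (r / e) powr a"
        using r assms by (simp add: powr_divide)
      also have "r / e = d powr (- z)" using dz by (simp add: powr_minus)
      also have "(d powr (- z)) powr a = \<sigma> powr z"
        unfolding a_def powr_geometric[OF assms(1,2), symmetric] ..
      finally have "(1 / e) powr a * r powr a = \<sigma> powr z" .
      moreover have "\<sigma> powr (real n + 1) \<le> \<sigma> powr z" using n assms by (intro powr_mono') auto
      ultimately show ?thesis using assms by (simp add: powr_realpow powr_add field_simps)
    qed
    finally show ?thesis using assms(4) by (simp add: mult_ac)
  qed
  then show ?thesis unfolding a_def[symmetric] using assms
    by (intro lower_local_dim_ge[of "K / \<sigma> * (1 / e) powr a" "min e R"]) auto
qed


section \<open>Measures invariant under random digits\<close>

lemma abs_divide_diff: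
  fixes a x D :: real
  assumes "D > 0"
  shows "\<bar>a / D - x\<bar> = \<bar>a - D * x\<bar> / D"
proof -
  have "a / D - x = (a - D * x) / D" using assms by (simp add: field_simps)
  then show ?thesis using assms by simp
qed

text \<open>For \<open>X\<close> of law \<open>\<nu>\<close> and an independent digit
  \<open>b\<close> of law \<open>q\<close>, the variable \<open>(X + s b) / d\<close> has law
  \<open>\<nu>\<close> again. The normalized powers of \<open>\<mu>\<close> are the instances with
  \<open>M = k * m\<close>. Integrals of functions, rather than masses of sets, let the invariance
  be iterated by substitution.\<close>

locale digit_measure = prob_space \<nu> for \<nu> :: "real measure" +
  fixes d M :: nat and q :: "nat pmf"
  assumes sets_\<nu> [measurable_cong, simp]: "sets \<nu> = sets borel"
    and d_ge_2: "d \<ge> 2" and digits: "d - 1 \<le> M" "set_pmf q = {..M}"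
    and invariant: "\<And>f. f \<in> borel_measurable borel \<Longrightarrow> (\<integral>\<^sup>+x. f x \<partial>\<nu>)
      = (\<integral>\<^sup>+b. (\<integral>\<^sup>+x. f ((x + (real d - 1) / M * real b) / real d) \<partial>\<nu>) \<partial>q)"
begin

text \<open>The level-\<open>n\<close> cells run from \<open>s u / d^n\<close> to
  \<open>(s u + 1) / d^n\<close>, so \<open>s\<close> is their spacing in units of their length.
  With \<open>s * M = d - 1\<close>, the map of the top digit fixes 1.\<close>

definition s :: real where "s = (real d - 1) / M"

lemma d_pos: "d > 0" and s_pos: "s > 0" and s_M: "s * M = real d - 1"
  using d_ge_2 digits by (auto simp: s_def)

lemma space_\<nu> [simp]: "space \<nu> = UNIV"
  using sets_eq_imp_space_eq[OF sets_\<nu>] by simp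

lemma finite_q [simp]: "finite (set_pmf q)"
  using digits by simp

section \<open>Level-\<open>n\<close> cells and the support of \<open>\<nu>\<close>\<close>

abbreviation Q :: "nat \<Rightarrow> nat pmf" where "Q \<equiv> digit_sum d q"

abbreviation top_index :: "nat \<Rightarrow> nat" where "top_index n \<equiv> M * (\<Sum>i<n. d ^ i)"

lemma s_top: "s * top_index n = real d ^ n - 1"
proof -
  have "s * top_index n = (real d - 1) * (\<Sum>i<n. real d ^ i)"
    using s_M by (simp add: mult.assoc[symmetric])
  then show ?thesis using power_diff_1_eq[of "real d" n] by simp
qed

lemma s_digit_sum_le: "u \<in> set_pmf (Q n) \<Longrightarrow> s * u \<le> real d ^ n - 1"
  using set_digit_sum_le[of q M u d n] digits s_pos unfolding s_top[symmetric]
  by (simp del: of_nat_mult of_nat_sum)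

text \<open>Drawing the new lowest digit last instead of first describes the subdivision of a given
  level-\<open>n\<close> cell.\<close>

lemma Q_Suc_commute: "Q (Suc n) = bind_pmf (Q n) (\<lambda>u. map_pmf (\<lambda>b. d * u + b) q)"
  unfolding digit_sum.simps map_pmf_def by (rule bind_commute_pmf)

lemma nn_integral_iterate:
  assumes [measurable]: "f \<in> borel_measurable borel"
  shows "(\<integral>\<^sup>+x. f x \<partial>\<nu>) = (\<integral>\<^sup>+u. (\<integral>\<^sup>+x. f ((x + s * real u) / real d ^ n) \<partial>\<nu>) \<partial>Q n)"
proof (induction n)
  case (Suc n)
  have "(\<integral>\<^sup>+u. (\<integral>\<^sup>+x. f ((x + s * real u) / real d ^ Suc n) \<partial>\<nu>) \<partial>Q (Suc n))
    = (\<integral>\<^sup>+u. (\<integral>\<^sup>+b. (\<integral>\<^sup>+x. f (((x + s * b) / d + s * u) / real d ^ n) \<partial>\<nu>) \<partial>q) \<partial>Q n)"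
    unfolding Q_Suc_commute using d_pos
    by (simp add: add_divide_distrib distrib_left mult_ac add_ac)
  also have "\<dots> = (\<integral>\<^sup>+u. (\<integral>\<^sup>+x. f ((x + s * u) / real d ^ n) \<partial>\<nu>) \<partial>Q n)"
    unfolding s_def by (intro nn_integral_cong invariant[symmetric]) simp
  finally show ?case using Suc by simp
qed simp

lemma emeasure_iterate:
  assumes [measurable]: "A \<in> sets borel"
  shows "emeasure \<nu> A = (\<integral>\<^sup>+u. emeasure \<nu> {x. (x + s * real u) / real d ^ n \<in> A} \<partial>Q n)"
proof -
  have [measurable]: "{x. (x + s * real u) / real d ^ n \<in> A} \<in> sets \<nu>" for u
    by measurable
  have "emeasure \<nu> A = (\<integral>\<^sup>+x. indicator A x \<partial>\<nu>)" by simp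
  also have "\<dots> = (\<integral>\<^sup>+u. (\<integral>\<^sup>+x. indicator A ((x + s * real u) / real d ^ n) \<partial>\<nu>) \<partial>Q n)"
    by (rule nn_integral_iterate) simp
  also have "\<dots> = (\<integral>\<^sup>+u. (\<integral>\<^sup>+x. indicator {x. (x + s * real u) / real d ^ n \<in> A} x \<partial>\<nu>) \<partial>Q n)"
    by (intro nn_integral_cong) (simp add: indicator_def)
  finally show ?thesis by simp
qed

text \<open>The level-\<open>n\<close> maps send the \<open>d^n R\<close>-neighbourhood of the unit
  interval into its \<open>R\<close>-neighbourhood, so the former has no larger mass. As
  \<open>n\<close> grows, the former exhausts the line.\<close>

lemma measure_neighbourhood_unit_interval:
  assumes "R > 0"
  shows "prob {-R..1 + R} = 1"
proof -
  have *: "prob {- (real d ^ n * R)..1 + real d ^ n * R} \<le> prob {-R..1 + R}" for n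
  proof -
    have "emeasure \<nu> {- (real d ^ n * R)..1 + real d ^ n * R}
        = (\<integral>\<^sup>+u. emeasure \<nu> {- (real d ^ n * R)..1 + real d ^ n * R} \<partial>Q n)"
      by (simp add: measure_pmf.emeasure_space_1)
    also have "\<dots> \<le> (\<integral>\<^sup>+u. emeasure \<nu> {x. (x + s * real u) / real d ^ n \<in> {-R..1 + R}} \<partial>Q n)"
    proof (intro nn_integral_mono_AE, unfold AE_measure_pmf_iff, intro ballI emeasure_mono subsetI)
      fix u x assume u: "u \<in> set_pmf (Q n)" and x: "x \<in> {- (real d ^ n * R)..1 + real d ^ n * R}"
      have "0 \<le> s * u" using s_pos by simp
      then show "x \<in> {x. (x + s * real u) / real d ^ n \<in> {-R..1 + R}}"
        using s_digit_sum_le[OF u] x d_pos by (auto simp: field_simps)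
    qed simp
    also have "\<dots> = emeasure \<nu> {-R..1 + R}"
      by (rule emeasure_iterate[symmetric]) simp
    finally show ?thesis by (simp add: emeasure_eq_measure)
  qed
  have "(\<lambda>n. prob {- (real d ^ n * R)..1 + real d ^ n * R})
      \<longlonglongrightarrow> prob (\<Union>n. {- (real d ^ n * R)..1 + real d ^ n * R})"
  proof (intro finite_Lim_measure_incseq incseq_SucI)
    fix n
    have "real d ^ n * R \<le> real d ^ Suc n * R" using assms d_pos by simp
    then show "{- (real d ^ n * R)..1 + real d ^ n * R} \<le> {- (real d ^ Suc n * R)..1 + real d ^ Suc n * R}"
      unfolding atLeastatMost_subset_iff by linarith
  qed auto
  also have "(\<Union>n. {- (real d ^ n * R)..1 + real d ^ n * R}) = UNIV"
  proof (intro equalityI subsetI UNIV_I)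
    fix x :: real
    obtain n where "\<bar>x\<bar> / R < real d ^ n"
      using real_arch_pow[of "real d"] d_ge_2 by auto
    then have "\<bar>x\<bar> < real d ^ n * R" using assms by (simp add: field_simps)
    then have "x \<in> {- (real d ^ n * R)..1 + real d ^ n * R}" unfolding atLeastAtMost_iff by linarith
    then show "x \<in> (\<Union>n. {- (real d ^ n * R)..1 + real d ^ n * R})" by blast
  qed
  finally have "prob UNIV \<le> prob {-R..1 + R}"
    by (rule LIMSEQ_le_const2) (use * in blast)
  then show ?thesis using prob_space prob_le_1 by (intro antisym) auto
qed

lemma AE_unit_interval: "AE x in \<nu>. x \<in> {0..1}"
proof -
  have "AE x in \<nu>. x \<in> {- inverse (real (Suc n))..1 + inverse (real (Suc n))}" for n
    using measure_neighbourhood_unit_interval[of "inverse (real (Suc n))"]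
    by (intro prob_eq_1[THEN iffD1]) auto
  then have "AE x in \<nu>. \<forall>n. x \<in> {- inverse (real (Suc n))..1 + inverse (real (Suc n))}"
    by (simp add: AE_all_countable)
  then show ?thesis
  proof eventually_elim
    case (elim x)
    show ?case
    proof (rule ccontr)
      assume "x \<notin> {0..1}"
      then have "max (- x) (x - 1) > 0" by auto
      then obtain n where "inverse (real (Suc n)) < max (- x) (x - 1)"
        using reals_Archimedean by blast
      then show False using elim[rule_format, of n] unfolding atLeastAtMost_iff by linarith
    qed
  qed
qed

text \<open>Given the index \<open>u\<close>, the point lies almost surely in the cell of
  \<open>u\<close>, so only cells that meet \<open>A\<close> contribute.\<close>

lemma measure_le_digit_sum:
  assumes [measurable]: "A \<in> sets borel"
    and U: "\<And>u y. u \<in> set_pmf (Q n) \<Longrightarrow> y \<in> {0..1} \<Longrightarrow> (y + s * real u) / real d ^ n \<in> A \<Longrightarrow> u \<in> U"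
  shows "prob A \<le> measure (Q n) U"
proof -
  have "emeasure \<nu> A \<le> (\<integral>\<^sup>+u. indicator U u \<partial>Q n)"
    unfolding emeasure_iterate[OF assms(1), of n]
  proof (intro nn_integral_mono_AE, unfold AE_measure_pmf_iff, intro ballI)
    fix u assume u: "u \<in> set_pmf (Q n)"
    show "emeasure \<nu> {x. (x + s * real u) / real d ^ n \<in> A} \<le> indicator U u"
    proof (cases "u \<in> U")
      case True
      then show ?thesis by (simp add: emeasure_le_1)
    next
      case False
      have "AE x in \<nu>. \<not> (x + s * real u) / real d ^ n \<in> A"
        using AE_unit_interval by eventually_elim (use U[OF u] False in blast)
      then have "emeasure \<nu> {x \<in> space \<nu>. (x + s * real u) / real d ^ n \<in> A} = 0"
        by (intro emeasure_eq_0_AE)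
      then show ?thesis by simp
    qed
  qed
  then show ?thesis by (simp add: emeasure_eq_measure measure_pmf.emeasure_eq_measure)
qed

lemma pmf_digit_sum_le_measure:
  assumes [measurable]: "A \<in> sets borel"
    and A: "\<And>y. y \<in> {0..1} \<Longrightarrow> (y + s * real u) / real d ^ n \<in> A"
  shows "pmf (Q n) u \<le> prob A"
proof -
  have "(\<integral>\<^sup>+v. indicator {u} v \<partial>Q n) \<le> emeasure \<nu> A"
    unfolding emeasure_iterate[OF assms(1), of n]
  proof (intro nn_integral_mono)
    fix v
    have "AE x in \<nu>. (x + s * real u) / real d ^ n \<in> A"
      using AE_unit_interval by eventually_elim (use A in blast)
    then have "emeasure \<nu> {x \<in> space \<nu>. (x + s * real u) / real d ^ n \<in> A} = 1"
      by (intro emeasure_eq_1_AE) auto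
    then show "indicator {u} v \<le> emeasure \<nu> {x. (x + s * real v) / real d ^ n \<in> A}"
      by (simp add: indicator_def)
  qed
  then show ?thesis by (simp add: emeasure_eq_measure emeasure_pmf_single)
qed

text \<open>Treats both endpoints. \<open>i n\<close> indexes the extreme cell: it stays within
  \<open>1 / d^n\<close> of \<open>x\<close>, while every other cell is farther away than half the
  spacing. So the mass near \<open>x\<close> is comparable to \<open>w ^ n\<close> from both
  sides.\<close>

lemma local_dim_endpoint:
  fixes i :: "nat \<Rightarrow> nat"
  assumes w: "0 < w" "w \<le> 1" and pmf_i: "\<And>n. pmf (Q n) (i n) = w ^ n"
    and cell: "\<And>n y. y \<in> {0..1} \<Longrightarrow> \<bar>(y + s * i n) / real d ^ n - x\<bar> \<le> 1 / real d ^ n"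
    and unique: "\<And>n u y. u \<in> set_pmf (Q n) \<Longrightarrow> y \<in> {0..1} \<Longrightarrow>
      \<bar>(y + s * u) / real d ^ n - x\<bar> \<le> s / 2 / real d ^ n \<Longrightarrow> u = i n"
  shows "has_local_dim \<nu> x (ereal (- ln w / ln (real d)))"
proof -
  have lower: "1 * w ^ n \<le> prob {x - r..x + r}" if "1 * (1 / real d) ^ n \<le> r" for n r
    unfolding pmf_i[symmetric] mult_1
  proof (rule pmf_digit_sum_le_measure)
    fix y :: real assume "y \<in> {0..1}"
    from cell[OF this, of n] show "(y + s * real (i n)) / real d ^ n \<in> {x - r..x + r}"
      using that by (simp add: power_one_over abs_le_iff)
  qed simp
  have upper: "prob {x - r..x + r} \<le> 1 * w ^ n" if "r \<le> s / 2 * (1 / real d) ^ n" for n r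
  proof -
    have "prob {x - r..x + r} \<le> measure (Q n) {i n}"
    proof (rule measure_le_digit_sum)
      fix u and y :: real
      assume u: "u \<in> set_pmf (Q n)" "y \<in> {0..1}" and "(y + s * real u) / real d ^ n \<in> {x - r..x + r}"
      then have "\<bar>(y + s * real u) / real d ^ n - x\<bar> \<le> r" by (simp add: abs_le_iff)
      also note that
      finally show "u \<in> {i n}" using unique[OF u] by (simp add: power_one_over)
    qed simp
    then show ?thesis by (simp add: measure_pmf_single pmf_i)
  qed
  have pos: "0 < prob {x - r..x + r}" if r: "0 < r" "r < 1" for r
  proof -
    obtain n where "(1 / real d) ^ n < r" using real_arch_pow_inv[OF r(1), of "1 / real d"] d_ge_2 by auto
    then have "1 * w ^ n \<le> prob {x - r..x + r}" by (intro lower) simp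
    then show ?thesis using w zero_less_power[of w n] by linarith
  qed
  have "upper_local_dim \<nu> x \<le> ereal (- ln w / ln (real d))"
    by (rule upper_local_dim_le_geometric[where c = 1 and e = 1 and N = 0])
      (use d_ge_2 w lower in auto)
  moreover have "ereal (- ln w / ln (real d)) \<le> lower_local_dim \<nu> x"
    by (rule lower_local_dim_ge_geometric[where K = 1 and e = "s / 2" and R = 1])
      (use d_ge_2 w upper pos s_pos in auto)
  ultimately show ?thesis
    unfolding has_local_dim_iff using lower_le_upper_local_dim[of \<nu> x] by (auto intro: antisym)
qed

lemma local_dim_0: "has_local_dim \<nu> 0 (ereal (- ln (pmf q 0) / ln (real d)))"
proof (rule local_dim_endpoint[where i = "\<lambda>n. 0"])
  fix n u and y :: real
  assume y: "y \<in> {0..1}" and le: "\<bar>(y + s * real u) / real d ^ n - 0\<bar> \<le> s / 2 / real d ^ n"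
  then have "(y + s * real u) / real d ^ n \<le> s / 2 / real d ^ n" by linarith
  moreover have "real d ^ n > 0" using d_pos by simp
  ultimately have "y + s * real u \<le> s / 2" unfolding divide_le_cancel by blast
  moreover have "0 \<le> y" using y by simp
  ultimately have "s * real u < s * 1" using s_pos by linarith
  then have "real u < 1" using s_pos by (simp only: mult_less_cancel_left_pos)
  then show "u = 0" by simp
qed (use digits in \<open>auto simp: pmf_positive_iff pmf_le_1 pmf_digit_sum_0 d_pos divide_right_mono\<close>)

lemma local_dim_1: "has_local_dim \<nu> 1 (ereal (- ln (pmf q M) / ln (real d)))"
proof (rule local_dim_endpoint[where i = top_index])
  have D: "real d ^ n > 0" for n using d_pos by simp
  fix n and y :: real assume y: "y \<in> {0..1}"
  \<comment> \<open>By \<open>s_top\<close> the top cell ends at 1, so indices can be counted back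
    from \<open>top_index n\<close>.\<close>
  have shift: "(y + s * real u) / real d ^ n - 1 = (y - 1 + (s * real u - s * top_index n)) / real d ^ n" for u
    using D[of n] unfolding s_top by (simp add: field_simps)
  show "\<bar>(y + s * top_index n) / real d ^ n - 1\<bar> \<le> 1 / real d ^ n"
    unfolding shift using y by (simp add: abs_divide divide_right_mono)
  fix u
  assume u: "u \<in> set_pmf (Q n)" and le: "\<bar>(y + s * real u) / real d ^ n - 1\<bar> \<le> s / 2 / real d ^ n"
  then have "- (s / 2) / real d ^ n \<le> (y - 1 + (s * real u - s * top_index n)) / real d ^ n"
    unfolding shift by linarith
  then have "- (s / 2) \<le> y - 1 + (s * real u - s * top_index n)"
    using D[of n] unfolding divide_le_cancel by blast
  then have "s * real (top_index n) < s * (real u + 1)" using y s_pos unfolding distrib_left atLeastAtMost_iff by linarith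
  then have "real (top_index n) < real u + 1" using s_pos by (simp only: mult_less_cancel_left_pos)
  then have "top_index n \<le> u" by linarith
  moreover have "u \<le> top_index n" using set_digit_sum_le[OF _ u] digits by simp
  ultimately show "u = top_index n" by simp
qed (use digits in \<open>auto simp: pmf_positive_iff pmf_le_1 pmf_digit_sum_top d_pos\<close>)

section \<open>Interior points\<close>

lemma card_nat_interval:
  fixes a L :: real
  assumes "L \<ge> 0"
  shows "finite {u::nat. a \<le> real u \<and> real u \<le> a + L}" (is "finite ?U")
    and "card {u::nat. a \<le> real u \<and> real u \<le> a + L} \<le> L + 1"
proof -
  have sub: "int ` ?U \<subseteq> {\<lceil>a\<rceil>..\<lfloor>a + L\<rfloor>}"
    by (auto simp: ceiling_le_iff le_floor_iff)
  then have fin: "finite (int ` ?U)" by (rule finite_subset) simp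
  then show "finite ?U" by (simp add: finite_image_iff)
  have "card ?U = card (int ` ?U)" by (simp add: card_image)
  also have "\<dots> \<le> card {\<lceil>a\<rceil>..\<lfloor>a + L\<rfloor>}" by (rule card_mono) (use sub in auto)
  finally have "card ?U \<le> nat (\<lfloor>a + L\<rfloor> + 1 - \<lceil>a\<rceil>)" by simp
  then show "card ?U \<le> L + 1" using assms by linarith
qed

text \<open>Magnified by \<open>d^n\<close>, the ball has radius at most 1 and cells have length 1,
  so \<open>s u\<close> is confined to an interval of length 3. At most \<open>3 / s + 1\<close>
  indices remain, each of probability at most \<open>\<sigma> ^ n\<close>.\<close>

lemma measure_ball_le:
  assumes \<sigma>: "\<And>c. measure q {b. b mod d = c mod d} \<le> \<sigma>"
    and r: "r \<le> 1 * (1 / real d) ^ n"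
  shows "prob {x - r..x + r} \<le> (3 / s + 1) * \<sigma> ^ n"
proof -
  define U where "U = {u::nat. (x * real d ^ n - 2) / s \<le> real u \<and> real u \<le> (x * real d ^ n - 2) / s + 3 / s}"
  have U: "finite U" "card U \<le> 3 / s + 1"
    unfolding U_def using s_pos card_nat_interval[of "3 / s"] by auto
  have "prob {x - r..x + r} \<le> measure (Q n) U"
  proof (rule measure_le_digit_sum)
    fix u and y :: real assume y: "y \<in> {0..1}" and "(y + s * real u) / real d ^ n \<in> {x - r..x + r}"
    then have "\<bar>(y + s * real u) / real d ^ n - x\<bar> \<le> 1 / real d ^ n"
      using r by (simp add: power_one_over abs_le_iff)
    moreover have D: "real d ^ n > 0" using d_pos by simp
    ultimately have "\<bar>y + s * real u - real d ^ n * x\<bar> \<le> 1"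
      unfolding abs_divide_diff[OF D] divide_le_cancel by blast
    then have "x * real d ^ n - 2 \<le> s * real u" "s * real u \<le> x * real d ^ n + 1"
      using y by (auto simp: abs_le_iff mult.commute)
    then show "u \<in> U" unfolding U_def using s_pos by (simp add: field_simps)
  qed simp
  also have "\<dots> = (\<Sum>u\<in>U. pmf (Q n) u)" by (rule measure_measure_pmf_finite[OF U(1)])
  also have "\<dots> \<le> card U * \<sigma> ^ n"
    by (intro sum_bounded_above pmf_digit_sum_upper d_pos finite_q \<sigma>)
  also have "\<dots> \<le> (3 / s + 1) * \<sigma> ^ n"
    using U \<sigma>[of 0] measure_nonneg[of q] order_trans by (intro mult_right_mono zero_le_power) blast+
  finally show ?thesis .
qed

text \<open>The position \<open>y = d^n x - s u\<close> of \<open>x\<close> in the level-\<open>n\<close> cell with index \<open>u\<close> becomes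
  \<open>(y + s b) / d\<close> in the parent cell. If \<open>s b / (d - 1)\<close> is within \<open>\<delta>\<close> of \<open>\<theta>\<close>, this map
  preserves the window \<open>\<bar>y - \<theta>\<bar> \<le> \<delta>\<close>, so no mass carried by such digits is lost.\<close>

lemma pmf_digit_sum_lower:
  fixes x \<theta> \<delta> \<rho> :: real
  assumes x: "1 \<le> real d ^ n0 * x" "1 \<le> real d ^ n0 * (1 - x)"
    and \<theta>: "\<delta> \<le> \<theta>" "\<theta> + \<delta> \<le> 1"
    and \<rho>: "0 < \<rho>" "\<And>c. \<rho> \<le> measure q {b. b mod d = c mod d \<and> \<bar>real b - \<theta> * M\<bar> \<le> \<delta> * M}"
  obtains c where "c > 0"
    "\<And>n u. n0 \<le> n \<Longrightarrow> \<bar>real d ^ n * x - s * real u - \<theta>\<bar> \<le> \<delta> \<Longrightarrow> c * \<rho> ^ n \<le> pmf (Q n) u"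
proof -
  \<comment> \<open>The minimum is positive since \<open>set_digit_sum\<close> leaves no index up to
    \<open>top_index n0\<close> without mass.\<close>
  define c where "c = Min ((pmf (Q n0)) ` {..top_index n0})"
  have "c > 0" unfolding c_def
    using set_digit_sum[OF digits(2,1) d_pos, of n0] by (subst Min_gr_iff) (auto simp: pmf_positive_iff)
  have "\<rho> \<le> 1" using \<rho>(2)[of 0] measure_pmf.prob_le_1 order_trans by blast
  have "c * \<rho> ^ n \<le> pmf (Q n) u" if "n0 \<le> n" "\<bar>real d ^ n * x - s * real u - \<theta>\<bar> \<le> \<delta>" for n u
    using that
  proof (induction n arbitrary: u rule: dec_induct)
    case base
    \<comment> \<open>\<open>\<delta> \<le> \<theta>\<close> gives \<open>s u \<le> d^n0 x\<close>,
      and the distance of \<open>x\<close> from 1 bounds this by \<open>d^n0 - 1\<close>.\<close>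
    have "s * u \<le> s * top_index n0"
      unfolding s_top using base x \<theta> by (simp add: algebra_simps abs_le_iff)
    then have "u \<le> top_index n0" using s_pos by (simp only: mult_le_cancel_left_pos of_nat_le_iff)
    then have "c \<le> pmf (Q n0) u" unfolding c_def by (intro Min_le) auto
    moreover have "c * \<rho> ^ n0 \<le> c * 1" using \<open>c > 0\<close> \<rho>(1) \<open>\<rho> \<le> 1\<close> by (intro mult_left_mono power_le_one) auto
    ultimately show ?case by linarith
  next
    case (step n)
    define B where "B = {b. b mod d = u mod d \<and> \<bar>real b - \<theta> * M\<bar> \<le> \<delta> * M}"
    have "c * \<rho> ^ Suc n = \<rho> * (c * \<rho> ^ n)" by simp
    also have "\<dots> \<le> measure q B * (c * \<rho> ^ n)"
      unfolding B_def using \<rho>(1) \<open>c > 0\<close> by (intro mult_right_mono \<rho>(2)) auto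
    also have "\<dots> = (\<integral>b. indicator B b * (c * \<rho> ^ n) \<partial>q)" by simp
    also have "\<dots> \<le> pmf (Q (Suc n)) u"
      unfolding pmf_digit_sum_Suc[OF d_pos]
    proof (intro integral_mono_AE integrable_measure_pmf_finite finite_q, unfold AE_measure_pmf_iff, intro ballI)
      fix b assume "b \<in> set_pmf q"
      then have "b \<le> M" using digits by auto
      show "indicator B b * (c * \<rho> ^ n)
        \<le> (if b \<le> u \<and> u mod d = b mod d then pmf (Q n) ((u - b) div d) else 0)"
      proof (cases "b \<in> B")
        case True
        have y: "\<bar>real d * (real d ^ n * x) - s * real u - \<theta>\<bar> \<le> \<delta>" using step.prems by (simp add: mult.assoc)
        have "real d ^ n0 * x \<le> real d ^ n * x"
          using step.hyps x(1) d_ge_2 zero_less_mult_pos[of "real d ^ n0" x] by (intro mult_right_mono power_increasing) auto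
        then have "real d * 1 \<le> real d * (real d ^ n * x)" using x(1) by (intro mult_left_mono) auto
        \<comment> \<open>As \<open>d^n x \<ge> 1\<close> and
          \<open>\<theta> + \<delta> \<le> 1\<close>, \<open>s u\<close> is at least
          \<open>d - 1\<close>. So even the largest digit can be split off from
          \<open>u\<close>.\<close>
        then have "s * M \<le> s * u" using y \<theta> unfolding s_M by (simp add: abs_le_iff)
        then have "M \<le> u" using s_pos by (simp only: mult_le_cancel_left_pos of_nat_le_iff)
        then have "b \<le> u" using \<open>b \<le> M\<close> by simp
        moreover have mod: "b mod d = u mod d" using True by (simp add: B_def)
        ultimately have "d dvd u - b" using mod_eq_dvd_iff_nat[of b u d] by simp
        then obtain v where "u - b = d * v" by blast
        then have u: "u = d * v + b" using \<open>b \<le> u\<close> by linarith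
        have "s * \<bar>real b - \<theta> * M\<bar> \<le> s * (\<delta> * M)" using True s_pos by (intro mult_left_mono) (auto simp: B_def)
        then have "\<bar>s * b - \<theta> * (s * M)\<bar> \<le> \<delta> * (s * M)"
          using s_pos by (simp add: abs_mult_pos' right_diff_distrib mult_ac)
        then have "s * b - \<theta> * (real d - 1) \<le> \<delta> * (real d - 1)" "- (s * b - \<theta> * (real d - 1)) \<le> \<delta> * (real d - 1)"
          unfolding s_M abs_le_iff by auto
        \<comment> \<open>For the parent position \<open>y'\<close>, \<open>d (y' - \<theta>) = (y -
          \<theta>) + (s b - \<theta> (d - 1))\<close>, with terms bounded by
          \<open>\<delta>\<close> and \<open>\<delta> (d - 1)\<close>.\<close>
        then have "\<bar>real d * (real d ^ n * x - s * v - \<theta>)\<bar> \<le> real d * \<delta>"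
          using y unfolding u abs_le_iff by (simp add: algebra_simps)
        then have "\<bar>real d ^ n * x - s * v - \<theta>\<bar> \<le> \<delta>" using d_pos by (simp add: abs_mult)
        from step.IH[OF this] show ?thesis using mod d_pos by (simp add: u indicator_def)
      qed simp
    qed
    finally show ?case .
  qed
  with \<open>c > 0\<close> that show ?thesis by blast
qed

text \<open>\<open>s \<le> \<delta>\<close> ensures that at every level from some \<open>n0\<close>
  on, some cell contains \<open>x\<close> inside the window, so the lower estimate applies to
  it.\<close>

lemma interior_local_dim_bounds:
  fixes x \<theta> \<delta> \<rho> \<sigma> :: real
  assumes x: "0 < x" "x < 1"
    and \<theta>: "s \<le> \<delta>" "\<delta> \<le> \<theta>" "\<theta> + \<delta> \<le> 1"
    and \<rho>: "0 < \<rho>" "\<And>c. \<rho> \<le> measure q {b. b mod d = c mod d \<and> \<bar>real b - \<theta> * M\<bar> \<le> \<delta> * M}"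
    and \<sigma>: "\<sigma> \<le> 1" "\<And>c. measure q {b. b mod d = c mod d} \<le> \<sigma>"
  shows "ereal (- ln \<sigma> / ln (real d)) \<le> lower_local_dim \<nu> x" "upper_local_dim \<nu> x \<le> ereal (- ln \<rho> / ln (real d))"
proof -
  have "\<rho> \<le> \<sigma>"
    by (rule order_trans[OF \<rho>(2)[of 0] order_trans[OF _ \<sigma>(2)[of 0]]]) (auto intro!: measure_pmf.finite_measure_mono)
  obtain n0 where n0: "max (1 / x) (1 / (1 - x)) < real d ^ n0"
    using real_arch_pow[of "real d" "max (1 / x) (1 / (1 - x))"] d_ge_2 by (auto simp del: max_less_iff_conj)
  then have n0': "1 \<le> real d ^ n0 * x" "1 \<le> real d ^ n0 * (1 - x)" using x by (auto simp: field_simps)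
  obtain c where c: "c > 0"
    "\<And>n u. n0 \<le> n \<Longrightarrow> \<bar>real d ^ n * x - s * real u - \<theta>\<bar> \<le> \<delta> \<Longrightarrow> c * \<rho> ^ n \<le> pmf (Q n) u"
    using pmf_digit_sum_lower[OF n0' \<theta>(2,3) \<rho>] by metis
  have lower: "c * \<rho> ^ n \<le> prob {x - r..x + r}" if "n0 \<le> n" "1 * (1 / real d) ^ n \<le> r" for n r
  proof -
    \<comment> \<open>At the real index \<open>z\<close> the point would sit exactly at
      \<open>\<theta>\<close>; rounding down moves it by at most
      \<open>s \<le> \<delta>\<close>.\<close>
    define z where "z = (real d ^ n * x - \<theta>) / s"
    define u where "u = nat \<lfloor>z\<rfloor>"
    have "real d ^ n0 * x \<le> real d ^ n * x"
      using that x d_ge_2 by (intro mult_right_mono power_increasing) auto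
    then have "0 \<le> z" using s_pos n0' \<theta> by (simp add: z_def)
    then have "real u \<le> z" "z \<le> real u + 1" unfolding u_def by linarith+
    then have "s * u \<le> s * z" "s * z \<le> s * (real u + 1)" using s_pos by simp_all
    moreover have "s * z = real d ^ n * x - \<theta>" using s_pos by (simp add: z_def)
    ultimately have y: "\<bar>real d ^ n * x - s * u - \<theta>\<bar> \<le> \<delta>" using \<theta> s_pos by (simp add: abs_le_iff distrib_left)
    have "pmf (Q n) u \<le> prob {x - r..x + r}"
    proof (rule pmf_digit_sum_le_measure)
      fix t :: real assume "t \<in> {0..1}"
      then have "\<bar>t + s * u - real d ^ n * x\<bar> \<le> 1" using y \<theta> by (simp add: abs_le_iff)
      then have "\<bar>t + s * u - real d ^ n * x\<bar> / real d ^ n \<le> 1 / real d ^ n" by (intro divide_right_mono) auto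
      also have "\<dots> \<le> r" using that by (simp add: power_one_over)
      also have "\<bar>t + s * u - real d ^ n * x\<bar> / real d ^ n = \<bar>(t + s * u) / real d ^ n - x\<bar>"
        using d_pos by (subst abs_divide_diff) auto
      finally show "(t + s * u) / real d ^ n \<in> {x - r..x + r}" by (simp add: abs_le_iff)
    qed simp
    then show ?thesis using c(2)[OF that(1) y] by linarith
  qed
  show "upper_local_dim \<nu> x \<le> ereal (- ln \<rho> / ln (real d))"
    by (rule upper_local_dim_le_geometric[where c = c and e = 1 and N = n0])
      (use d_ge_2 \<rho> \<open>\<rho> \<le> \<sigma>\<close> \<sigma>(1) c(1) lower in auto)
  show "ereal (- ln \<sigma> / ln (real d)) \<le> lower_local_dim \<nu> x"
  proof (rule lower_local_dim_ge_geometric[where K = "3 / s + 1" and e = 1 and R = 1])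
    fix r :: real assume r: "0 < r" "r < 1"
    obtain n where n: "(1 / real d) ^ n < r" using real_arch_pow_inv[OF r(1), of "1 / real d"] d_ge_2 by auto
    have "(1 / real d) ^ max n n0 \<le> (1 / real d) ^ n" using d_ge_2 by (intro power_decreasing) auto
    then have "c * \<rho> ^ max n n0 \<le> prob {x - r..x + r}" using n by (intro lower) auto
    moreover have "0 < c * \<rho> ^ max n n0" using c \<rho> by simp
    ultimately show "0 < prob {x - r..x + r}" by linarith
  qed (use d_ge_2 \<rho> \<open>\<rho> \<le> \<sigma>\<close> \<sigma> s_pos measure_ball_le[OF \<sigma>(2)] in \<open>auto simp: add_pos_pos\<close>)
qed

end


section \<open>Convolution powers\<close>

text \<open>Finite support turns one integral into a finite sum, so measurability in
  \<open>x\<close> for each \<open>j\<close> suffices.\<close>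

lemma nn_integral_pmf_swap:
  fixes h :: "'a \<Rightarrow> 'b \<Rightarrow> ennreal"
  assumes fin: "finite (set_pmf P)" and [measurable]: "\<And>j. h j \<in> borel_measurable M"
  shows "(\<integral>\<^sup>+x. (\<integral>\<^sup>+j. h j x \<partial>P) \<partial>M) = (\<integral>\<^sup>+j. (\<integral>\<^sup>+x. h j x \<partial>M) \<partial>P)"
  by (simp add: nn_integral_measure_pmf_finite fin nn_integral_sum nn_integral_multc)

lemma conv_power_prob:
  assumes "prob_space \<mu>" and [simp, measurable_cong]: "sets \<mu> = sets borel"
  shows "prob_space (conv_power \<mu> k) \<and> sets (conv_power \<mu> k) = sets borel"
proof (induction k)
  case 0
  show ?case by (simp add: prob_space_return)
next
  case (Suc k)
  define C where "C = conv_power \<mu> k"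
  have C: "prob_space C" and [simp, measurable_cong]: "sets C = sets borel" using Suc by (auto simp: C_def)
  interpret prob_space \<mu> by fact
  interpret C: prob_space C by fact
  interpret pair_prob_space \<mu> C ..
  have "prob_space (distr (\<mu> \<Otimes>\<^sub>M C) borel (\<lambda>(x, y). x + y))"
    by (rule prob_space_distr) measurable
  then show ?case by (simp add: convolution_def C_def)
qed

text \<open>\<open>self_similar\<close> speaks of masses of sets. Writing \<open>\<mu>\<close> as
  the mixture of its contracted copies \<open>N j\<close> carries it over to integrals.\<close>

lemma self_similar_nn_integral:
  fixes P :: "nat pmf"
  assumes "prob_space \<mu>" and sets [simp, measurable_cong]: "sets \<mu> = sets borel"
    and ss: "self_similar d m p \<mu>"
    and P: "set_pmf P = {..m}" "\<And>j. j \<le> m \<Longrightarrow> pmf P j = p j"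
    and [measurable]: "f \<in> borel_measurable borel"
  shows "(\<integral>\<^sup>+x. f x \<partial>\<mu>) = (\<integral>\<^sup>+j. (\<integral>\<^sup>+x. f ((x + (real d - 1) / m * real j) / real d) \<partial>\<mu>) \<partial>P)"
proof -
  interpret prob_space \<mu> by fact
  have sp: "space \<mu> = UNIV" using sets_eq_imp_space_eq[OF sets] by simp
  have contr: "contr d m j = (\<lambda>x. (x + (real d - 1) / m * real j) / real d)" for j
    by (auto simp: contr_def add_divide_distrib fun_eq_iff)
  have [measurable]: "contr d m j \<in> borel_measurable borel" for j unfolding contr by measurable
  define N where "N j = distr \<mu> borel (contr d m j)" for j
  have "prob_space (distr \<mu> borel (contr d m j))" for j
    by (rule prob_space_distr) measurable
  then have N: "N \<in> measurable (measure_pmf P) (subprob_algebra borel)"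
    unfolding N_def by (auto simp: space_subprob_algebra intro!: prob_space_imp_subprob_space)
  have "\<mu> = measure_pmf P \<bind> N"
  proof (rule measure_eqI)
    show "sets \<mu> = sets (measure_pmf P \<bind> N)" by (subst sets_bind[where N = borel]) (auto simp: N_def)
    fix A assume "A \<in> sets \<mu>"
    then have [measurable]: "A \<in> sets borel" by simp
    have "emeasure (measure_pmf P \<bind> N) A = (\<integral>\<^sup>+j. emeasure (N j) A \<partial>P)"
      by (rule emeasure_bind[OF _ N]) auto
    also have "\<dots> = (\<Sum>j\<le>m. ennreal (measure \<mu> (contr d m j -` A)) * ennreal (p j))"
      using P by (subst nn_integral_measure_pmf_finite) (auto simp: N_def emeasure_distr sp emeasure_eq_measure)
    also have "\<dots> = (\<Sum>j\<le>m. ennreal (p j * measure \<mu> (contr d m j -` A)))"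
    proof (rule sum.cong)
      fix j assume "j \<in> {..m}"
      then have "p j \<ge> 0" using P(2)[of j] pmf_nonneg[of P j] by simp
      then show "ennreal (measure \<mu> (contr d m j -` A)) * ennreal (p j) = ennreal (p j * measure \<mu> (contr d m j -` A))"
        by (simp add: ennreal_mult mult.commute)
    qed simp
    also have "\<dots> = ennreal (\<Sum>j\<le>m. p j * measure \<mu> (contr d m j -` A))"
    proof (rule sum_ennreal)
      fix j assume "j \<in> {..m}"
      then show "0 \<le> p j * measure \<mu> (contr d m j -` A)" using P(2)[of j] pmf_nonneg[of P j] by simp
    qed
    also have "\<dots> = emeasure \<mu> A" using ss by (simp add: self_similar_def emeasure_eq_measure)
    finally show "emeasure \<mu> A = emeasure (measure_pmf P \<bind> N) A" ..
  qed
  then have "(\<integral>\<^sup>+x. f x \<partial>\<mu>) = (\<integral>\<^sup>+j. (\<integral>\<^sup>+x. f x \<partial>N j) \<partial>P)"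
    using nn_integral_bind[OF _ N, of f] by simp
  also have "\<dots> = (\<integral>\<^sup>+j. (\<integral>\<^sup>+x. f ((x + (real d - 1) / m * real j) / real d) \<partial>\<mu>) \<partial>P)"
    unfolding N_def by (subst nn_integral_distr) (auto simp: contr)
  finally show ?thesis .
qed

text \<open>Since both measures have the same ratio \<open>1 / t\<close>,
  \<open>(x + s j) / t + (y + s b) / t\<close> equals \<open>(x + y + s (j + b)) / t\<close>: digits
  simply add.\<close>

lemma convolution_invariant:
  fixes f :: "real \<Rightarrow> ennreal" and s t :: real and P q :: "nat pmf"
  assumes "prob_space \<mu>" "prob_space C"
    and [simp, measurable_cong]: "sets \<mu> = sets borel" "sets C = sets borel"
    and fin: "finite (set_pmf P)" "finite (set_pmf q)"
    and \<mu>: "\<And>f. f \<in> borel_measurable borel \<Longrightarrow>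
      (\<integral>\<^sup>+x. f x \<partial>\<mu>) = (\<integral>\<^sup>+j. (\<integral>\<^sup>+x. f ((x + s * real j) / t) \<partial>\<mu>) \<partial>P)"
    and C: "\<And>f. f \<in> borel_measurable borel \<Longrightarrow>
      (\<integral>\<^sup>+y. f y \<partial>C) = (\<integral>\<^sup>+b. (\<integral>\<^sup>+y. f ((y + s * real b) / t) \<partial>C) \<partial>q)"
    and [measurable]: "f \<in> borel_measurable borel"
  shows "(\<integral>\<^sup>+z. f z \<partial>(\<mu> \<star> C))
    = (\<integral>\<^sup>+j. (\<integral>\<^sup>+b. (\<integral>\<^sup>+z. f ((z + s * real (j + b)) / t) \<partial>(\<mu> \<star> C)) \<partial>q) \<partial>P)"
proof -
  interpret M: prob_space \<mu> by fact
  interpret C: prob_space C by fact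
  interpret pair_prob_space \<mu> C ..
  have conv: "(\<integral>\<^sup>+z. g z \<partial>(\<mu> \<star> C)) = (\<integral>\<^sup>+x. \<integral>\<^sup>+y. g (x + y) \<partial>C \<partial>\<mu>)"
    if "g \<in> borel_measurable borel" for g
    using that by (intro nn_integral_convolution) (simp_all add: M.finite_measure_axioms C.finite_measure_axioms)
  have "(\<integral>\<^sup>+z. f z \<partial>(\<mu> \<star> C)) = (\<integral>\<^sup>+x. \<integral>\<^sup>+y. f (x + y) \<partial>C \<partial>\<mu>)" by (rule conv) simp
  also have "\<dots> = (\<integral>\<^sup>+x. \<integral>\<^sup>+b. \<integral>\<^sup>+y. f (x + (y + s * real b) / t) \<partial>C \<partial>q \<partial>\<mu>)"
    by (intro nn_integral_cong C) measurable
  also have "\<dots> = (\<integral>\<^sup>+b. \<integral>\<^sup>+x. \<integral>\<^sup>+y. f (x + (y + s * real b) / t) \<partial>C \<partial>\<mu> \<partial>q)"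
    by (rule nn_integral_pmf_swap[OF fin(2)]) measurable
  \<comment> \<open>\<open>\<mu>\<close> is moved innermost so that its own invariance can be
    applied for fixed \<open>y\<close> and \<open>b\<close>.\<close>
  also have "\<dots> = (\<integral>\<^sup>+b. \<integral>\<^sup>+y. \<integral>\<^sup>+x. f (x + (y + s * real b) / t) \<partial>\<mu> \<partial>C \<partial>q)"
    by (intro nn_integral_cong Fubini'[symmetric]) measurable
  also have "\<dots> = (\<integral>\<^sup>+b. \<integral>\<^sup>+y. \<integral>\<^sup>+j. \<integral>\<^sup>+x. f ((x + s * real j) / t + (y + s * real b) / t) \<partial>\<mu> \<partial>P \<partial>C \<partial>q)"
    by (intro nn_integral_cong \<mu>) measurable
  also have "\<dots> = (\<integral>\<^sup>+b. \<integral>\<^sup>+j. \<integral>\<^sup>+y. \<integral>\<^sup>+x. f ((x + s * real j) / t + (y + s * real b) / t) \<partial>\<mu> \<partial>C \<partial>P \<partial>q)"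
    by (intro nn_integral_cong nn_integral_pmf_swap[OF fin(1)]) measurable
  also have "\<dots> = (\<integral>\<^sup>+b. \<integral>\<^sup>+j. \<integral>\<^sup>+x. \<integral>\<^sup>+y. f ((x + s * real j) / t + (y + s * real b) / t) \<partial>C \<partial>\<mu> \<partial>P \<partial>q)"
    by (intro nn_integral_cong Fubini') measurable
  also have "\<dots> = (\<integral>\<^sup>+j. \<integral>\<^sup>+b. \<integral>\<^sup>+x. \<integral>\<^sup>+y. f ((x + s * real j) / t + (y + s * real b) / t) \<partial>C \<partial>\<mu> \<partial>q \<partial>P)"
    by (rule nn_integral_pmf_swap[OF fin(1)]) simp
  also have "\<dots> = (\<integral>\<^sup>+j. \<integral>\<^sup>+b. \<integral>\<^sup>+x. \<integral>\<^sup>+y. f ((x + y + s * real (j + b)) / t) \<partial>C \<partial>\<mu> \<partial>q \<partial>P)"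
    by (simp add: add_divide_distrib distrib_left add_ac)
  also have "\<dots> = (\<integral>\<^sup>+j. \<integral>\<^sup>+b. (\<integral>\<^sup>+z. f ((z + s * real (j + b)) / t) \<partial>(\<mu> \<star> C)) \<partial>q \<partial>P)"
    by (intro nn_integral_cong conv[symmetric]) measurable
  finally show ?thesis .
qed

lemma conv_power_invariant:
  fixes s t :: real
  assumes "prob_space \<mu>" "sets \<mu> = sets borel" "finite (set_pmf P)"
    and \<mu>: "\<And>f. f \<in> borel_measurable borel \<Longrightarrow>
      (\<integral>\<^sup>+x. f x \<partial>\<mu>) = (\<integral>\<^sup>+j. (\<integral>\<^sup>+x. f ((x + s * real j) / t) \<partial>\<mu>) \<partial>P)"
    and "f \<in> borel_measurable borel"
  shows "(\<integral>\<^sup>+x. f x \<partial>conv_power \<mu> k)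
    = (\<integral>\<^sup>+b. (\<integral>\<^sup>+x. f ((x + s * real b) / t) \<partial>conv_power \<mu> k) \<partial>digit_sum 1 P k)"
  using assms(5)
proof (induction k arbitrary: f)
  case 0
  then have [measurable]: "f \<in> borel_measurable borel" .
  show ?case by (simp add: nn_integral_return)
next
  case (Suc k)
  have "(\<integral>\<^sup>+x. f x \<partial>conv_power \<mu> (Suc k)) = (\<integral>\<^sup>+j. (\<integral>\<^sup>+b. (\<integral>\<^sup>+z. f ((z + s * real (j + b)) / t)
      \<partial>(\<mu> \<star> conv_power \<mu> k)) \<partial>digit_sum 1 P k) \<partial>P)"
    unfolding conv_power.simps
  proof (rule convolution_invariant[OF assms(1) _ assms(2) _ assms(3) _ \<mu> Suc.IH Suc.prems])
    show "prob_space (conv_power \<mu> k)" "sets (conv_power \<mu> k) = sets borel"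
      using conv_power_prob[OF assms(1,2), of k] by blast+
  qed (use assms(3) in simp_all)
  then show ?case by (simp add: add_ac)
qed

text \<open>Division by \<open>k\<close> turns the step \<open>(d - 1) / m\<close> into
  \<open>(d - 1) / (k m)\<close>, which is the locale's step for the largest digit
  \<open>k * m\<close>.\<close>

lemma normalized_conv_power_digit_measure:
  assumes "prob_space \<mu>" "sets \<mu> = sets borel" "d \<ge> 2" "d - 1 \<le> m" "k \<ge> 1"
    and P: "set_pmf P = {..m}"
    and \<mu>: "\<And>f. f \<in> borel_measurable borel \<Longrightarrow> (\<integral>\<^sup>+x. f x \<partial>\<mu>)
      = (\<integral>\<^sup>+j. (\<integral>\<^sup>+x. f ((x + (real d - 1) / m * real j) / real d) \<partial>\<mu>) \<partial>P)"
  shows "digit_measure (normalized_conv_power \<mu> k) d (k * m) (digit_sum 1 P k)"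
proof -
  have C: "prob_space (conv_power \<mu> k)" and [simp, measurable_cong]: "sets (conv_power \<mu> k) = sets borel"
    using conv_power_prob[OF assms(1,2), of k] by auto
  interpret C: prob_space "conv_power \<mu> k" by fact
  interpret prob_space "normalized_conv_power \<mu> k"
    unfolding normalized_conv_power_def by (rule C.prob_space_distr) measurable
  show ?thesis
  proof
    show "sets (normalized_conv_power \<mu> k) = sets borel" by (simp add: normalized_conv_power_def)
    show "d \<ge> 2" by fact
    show "d - 1 \<le> k * m" using assms(4,5) by (metis le_trans mult_le_mono1 nat_mult_1)
    show "set_pmf (digit_sum 1 P k) = {..k * m}"
      using set_digit_sum[OF P, of 1 k] by (simp add: mult.commute)
    fix f :: "real \<Rightarrow> ennreal" assume [measurable]: "f \<in> borel_measurable borel"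
    have "(\<integral>\<^sup>+x. f x \<partial>normalized_conv_power \<mu> k) = (\<integral>\<^sup>+x. f (x / real k) \<partial>conv_power \<mu> k)"
      unfolding normalized_conv_power_def by (rule nn_integral_distr) measurable
    also have "\<dots> = (\<integral>\<^sup>+b. (\<integral>\<^sup>+x. f (((x + (real d - 1) / m * real b) / real d) / real k) \<partial>conv_power \<mu> k) \<partial>digit_sum 1 P k)"
      by (rule conv_power_invariant[OF assms(1,2) _ \<mu>]) (simp_all add: P)
    also have "\<dots> = (\<integral>\<^sup>+b. (\<integral>\<^sup>+x. f ((x / real k + (real d - 1) / real (k * m) * real b) / real d) \<partial>conv_power \<mu> k) \<partial>digit_sum 1 P k)"
      by (simp add: add_divide_distrib mult_ac)
    also have "\<dots> = (\<integral>\<^sup>+b. (\<integral>\<^sup>+x. f ((x + (real d - 1) / real (k * m) * real b) / real d) \<partial>normalized_conv_power \<mu> k) \<partial>digit_sum 1 P k)"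
      unfolding normalized_conv_power_def by (subst nn_integral_distr) auto
    finally show "(\<integral>\<^sup>+x. f x \<partial>normalized_conv_power \<mu> k)
      = (\<integral>\<^sup>+b. (\<integral>\<^sup>+x. f ((x + (real d - 1) / real (k * m) * real b) / real d) \<partial>normalized_conv_power \<mu> k) \<partial>digit_sum 1 P k)"
      by simp
  qed
qed

text \<open>Adding \<open>(d - 1) * c\<close> replaces subtraction of \<open>c\<close>; this brings
  residue classes into the form used in \<open>residue_equidistribution\<close>.\<close>

lemma mod_eq_iff_dvd_add:
  fixes b c d :: nat
  assumes "d > 0"
  shows "b mod d = c mod d \<longleftrightarrow> d dvd b + (d - 1) * c"
proof -
  have dc: "c + (d - 1) * c = d * c" using assms by (cases d) auto
  show ?thesis
  proof
    assume "b mod d = c mod d"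
    then have "(b + (d - 1) * c) mod d = (c + (d - 1) * c) mod d" by (rule mod_add_cong) simp
    then show "d dvd b + (d - 1) * c" unfolding dc by (simp add: dvd_eq_mod_eq_0)
  next
    assume "d dvd b + (d - 1) * c"
    then have "(c + (b + (d - 1) * c)) mod d = c mod d" by (metis add.right_neutral dvd_imp_mod_0 mod_add_right_eq)
    moreover have "c + (b + (d - 1) * c) = b + d * c" using dc by simp
    ultimately have "(b + d * c) mod d = c mod d" by (simp only:)
    then show "b mod d = c mod d" by simp
  qed
qed

lemma ln_power_quotient_tendsto_PInf:
  assumes "0 < w" "w < 1" "d > (1::real)"
  shows "(\<lambda>k. ereal (- ln (w ^ k) / ln d)) \<longlonglongrightarrow> \<infinity>"
proof -
  have "filterlim (\<lambda>k. (- ln w / ln d) * real k) at_top sequentially"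
    using assms by (intro filterlim_tendsto_pos_mult_at_top[OF tendsto_const _ filterlim_real_sequentially])
      (auto simp: divide_neg_pos)
  then show ?thesis using assms
    by (simp add: tendsto_PInfty_eq_at_top ln_realpow mult.commute)
qed

lemma mean_digit:
  fixes P :: "nat pmf"
  assumes P: "set_pmf P = {..m}" and "m > 0"
  shows "0 < (\<integral>j. real j \<partial>P)" "(\<integral>j. real j \<partial>P) < m"
proof -
  have int: "(\<integral>j. f j \<partial>P) = (\<Sum>j\<le>m. f j * pmf P j)" for f :: "nat \<Rightarrow> real"
    using P by (subst integral_measure_pmf_real[of "{..m}"]) auto
  have pos: "pmf P j > 0" if "j \<le> m" for j using P that by (auto simp: pmf_positive_iff)
  show "0 < (\<integral>j. real j \<partial>P)" unfolding int
    by (rule sum_pos2[of _ m]) (use \<open>m > 0\<close> pos in auto)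
  have "0 < (\<integral>j. real m - real j \<partial>P)" unfolding int
    by (rule sum_pos2[of _ 0]) (use \<open>m > 0\<close> pos in auto)
  also have "\<dots> = real m - (\<integral>j. real j \<partial>P)"
    using P by (subst Bochner_Integration.integral_diff) (auto simp: integrable_measure_pmf_finite)
  finally show "(\<integral>j. real j \<partial>P) < m" by simp
qed


theorem mainTheorem12:
  fixes d m :: nat and p :: "nat \<Rightarrow> real" and \<mu> :: "real measure"
  assumes "d \<ge> 2" and "m \<ge> d - 1"
    and "\<And>j. j \<le> m \<Longrightarrow> p j > 0" and "(\<Sum>j\<le>m. p j) = 1"
    and "prob_space \<mu>" and "sets \<mu> = sets borel"
    and "self_similar d m p \<mu>"
  shows "(\<forall>x\<in>{0<..<1}. local_dims_tendsto (normalized_conv_power \<mu>) x 1) \<and>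
         (\<forall>x\<in>{0, 1}. \<exists>D. (\<forall>k\<ge>1. has_local_dim (normalized_conv_power \<mu> k) x (D k)) \<and>
                         D \<longlonglongrightarrow> \<infinity>)"
proof -

  \<comment> \<open>The digit law and the measures \<open>\<nu> k\<close>\<close>
  define P where "P = embed_pmf (\<lambda>j. if j \<le> m then p j else 0)"
  have nonneg: "\<And>j. 0 \<le> (if j \<le> m then p j else 0)" using assms(3) by (auto intro: less_imp_le)
  have "(\<integral>\<^sup>+j. ennreal (if j \<le> m then p j else 0) \<partial>count_space UNIV) = (\<Sum>j\<le>m. ennreal (p j))"
    by (subst nn_integral_count_space'[of "{..m}"]) auto
  also have "\<dots> = 1" using assms(3,4) by (subst sum_ennreal) (auto intro: less_imp_le)
  finally have pmf_P: "pmf P j = (if j \<le> m then p j else 0)" and "set_pmf P = {j. (if j \<le> m then p j else 0) \<noteq> 0}" for j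
    unfolding P_def using nonneg by (auto simp: pmf_embed_pmf set_embed_pmf)
  then have set_P: "set_pmf P = {..m}" using assms(3) by (force split: if_splits)
  have fin: "finite (set_pmf P)" by (simp add: set_P)
  have m: "m > 0" using assms(1,2) by simp
  define \<nu> where "\<nu> = normalized_conv_power \<mu>"
  define q where "q = digit_sum 1 P"
  have \<mu>: "(\<integral>\<^sup>+x. f x \<partial>\<mu>) = (\<integral>\<^sup>+j. (\<integral>\<^sup>+x. f ((x + (real d - 1) / m * real j) / real d) \<partial>\<mu>) \<partial>P)"
    if "f \<in> borel_measurable borel" for f
    by (rule self_similar_nn_integral[OF assms(5-7) set_P _ that]) (simp add: pmf_P)
  have dm: "digit_measure (\<nu> k) d (k * m) (q k)" if "k \<ge> 1" for k
    unfolding \<nu>_def q_def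
    by (rule normalized_conv_power_digit_measure[OF assms(5,6,1,2) that set_P \<mu>])
  have p_less_1: "pmf P j < 1" if "i \<le> m" "i \<noteq> j" for i j
  proof -
    have "pmf P i + pmf P j = measure P {i, j}" using that by (simp add: measure_measure_pmf_finite)
    also have "\<dots> \<le> 1" by simp
    finally show ?thesis using pmf_P[of i] assms(3)[of i] that by simp
  qed

  \<comment> \<open>Endpoints: dimensions linear in \<open>k\<close>\<close>
  have "\<exists>D. (\<forall>k\<ge>1. has_local_dim (\<nu> k) x (D k)) \<and> D \<longlonglongrightarrow> \<infinity>" if x: "x \<in> {0, 1}" for x
  proof -
    define j where "j = (if x = 0 then 0 else m)"
    have j: "j \<le> m" "pmf P j < 1" "0 < pmf P j"
      using p_less_1[of m 0] p_less_1[of 0 m] m set_P by (auto simp: j_def pmf_positive_iff)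
    have "has_local_dim (\<nu> k) x (ereal (- ln (pmf P j ^ k) / ln (real d)))" if "k \<ge> 1" for k
    proof -
      interpret digit_measure "\<nu> k" d "k * m" "q k" using dm[OF that] .
      have "pmf (q k) 0 = pmf P 0 ^ k" "pmf (q k) (k * m) = pmf P m ^ k"
        unfolding q_def using pmf_digit_sum_0[of 1 P k] pmf_digit_sum_top[of 1 P m k] set_P
        by (simp_all add: mult.commute)
      then show ?thesis using local_dim_0 local_dim_1 x by (auto simp: j_def)
    qed
    moreover have "(\<lambda>k. ereal (- ln (pmf P j ^ k) / ln (real d))) \<longlonglongrightarrow> \<infinity>"
      by (rule ln_power_quotient_tendsto_PInf) (use j assms(1) in auto)
    ultimately show ?thesis by (intro exI[of _ "\<lambda>k. ereal (- ln (pmf P j ^ k) / ln (real d))"]) auto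
  qed

  \<comment> \<open>Interior points: limit 1\<close>
  moreover have "local_dims_tendsto \<nu> x 1" if x: "x \<in> {0<..<1}" for x
  proof -
    define e where "e = (\<integral>j. real j \<partial>P)"
    define V where "V = (\<integral>j. (real j - e)\<^sup>2 \<partial>P)"
    \<comment> \<open>The mean digit relative to the largest one. It serves all \<open>k\<close>,
      since mean \<open>k * e\<close> and maximum \<open>k * m\<close> scale alike.\<close>
    define \<theta> where "\<theta> = e / m"
    have \<theta>: "0 < \<theta>" "\<theta> < 1" using mean_digit[OF set_P m] m by (auto simp: \<theta>_def e_def)
    define \<delta> where "\<delta> = min \<theta> (1 - \<theta>)"
    have \<delta>: "0 < \<delta>" "\<delta> \<le> \<theta>" "\<theta> + \<delta> \<le> 1" using \<theta> by (auto simp: \<delta>_def)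
    \<comment> \<open>Positive because \<open>d - 1 \<le> m\<close> makes every number below
      \<open>d\<close> a digit.\<close>
    define \<eta> where "\<eta> = Min (pmf P ` {..<d})"
    have d_pos: "d > 0" using assms(1) by simp
    have d0: "{..<d} \<noteq> {}" using d_pos by (simp add: lessThan_empty_iff bot_nat_def)
    have \<eta>: "\<eta> > 0" "\<And>j. j < d \<Longrightarrow> \<eta> \<le> pmf P j"
      unfolding \<eta>_def using assms(1,2) set_P d0 by (auto simp: Min_gr_iff pmf_positive_iff)
    have "real d * \<eta> = (\<Sum>j<d. \<eta>)" by simp
    also have "\<dots> \<le> (\<Sum>j<d. pmf P j)" using \<eta> by (intro sum_mono) auto
    also have "\<dots> = measure P {..<d}" by (simp add: measure_measure_pmf_finite)
    finally have d\<eta>: "real d * \<eta> \<le> 1" using order_trans[OF _ measure_pmf.prob_le_1] by blast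
    \<comment> \<open>\<open>err\<close> bounds the deviation from equidistribution, and
      \<open>tl\<close> is the Chebyshev bound for leaving the window: variance of order
      \<open>k\<close> against squared radius of order \<open>k^2\<close>.\<close>
    define err where "err k = (1 - real d * \<eta>) ^ k" for k
    define tl where "tl k = k * V / (\<delta> * (k * m))\<^sup>2" for k :: nat
    define \<sigma> where "\<sigma> k = 1 / real d + err k" for k
    define \<rho> where "\<rho> k = 1 / real d - err k - tl k" for k
    have "err \<longlonglongrightarrow> 0" unfolding err_def
      using d\<eta> \<eta>(1) assms(1) by (intro LIMSEQ_power_zero) auto
    have "tl = (\<lambda>k. V / (\<delta> * m)\<^sup>2 * inverse (real k))"
      by (auto simp: tl_def fun_eq_iff power2_eq_square field_simps)
    also have "\<dots> \<longlonglongrightarrow> V / (\<delta> * m)\<^sup>2 * 0"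
      by (intro tendsto_mult tendsto_const lim_inverse_n)
    finally have "tl \<longlonglongrightarrow> 0" by simp
    have \<sigma>_lim: "\<sigma> \<longlonglongrightarrow> 1 / real d" and \<rho>_lim: "\<rho> \<longlonglongrightarrow> 1 / real d"
      unfolding \<sigma>_def \<rho>_def
      using tendsto_add[OF tendsto_const \<open>err \<longlonglongrightarrow> 0\<close>, of "1 / real d"]
        tendsto_diff[OF tendsto_diff[OF tendsto_const \<open>err \<longlonglongrightarrow> 0\<close>] \<open>tl \<longlonglongrightarrow> 0\<close>, of "1 / real d"]
      by simp_all
    have to_1: "(\<lambda>k. ereal (- ln (g k) / ln (real d))) \<longlonglongrightarrow> 1" if "g \<longlonglongrightarrow> 1 / real d" for g :: "nat \<Rightarrow> real"
    proof -
      have "(\<lambda>k. - ln (g k) / ln (real d)) \<longlonglongrightarrow> - ln (1 / real d) / ln (real d)"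
        using that assms(1) by (intro tendsto_intros) auto
      also have "- ln (1 / real d) / ln (real d) = 1" using assms(1) by (simp add: ln_div)
      finally show ?thesis by (simp add: one_ereal_def)
    qed
    \<comment> \<open>The spacing \<open>s\<close> for \<open>\<nu> k\<close> is
      \<open>(d - 1) / (k m)\<close>, so it eventually drops below the window radius.\<close>
    have "(\<lambda>k. (real d - 1) / m * inverse (real k)) \<longlonglongrightarrow> (real d - 1) / m * 0"
      by (intro tendsto_mult tendsto_const lim_inverse_n)
    then have "\<forall>\<^sub>F k in sequentially. (real d - 1) / m * inverse (real k) < \<delta>"
      using \<delta>(1) by (intro order_tendstoD) simp_all
    moreover have "\<forall>\<^sub>F k in sequentially. 0 < \<rho> k" "\<forall>\<^sub>F k in sequentially. \<sigma> k < 1"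
      using assms(1) by (auto intro!: order_tendstoD[OF \<rho>_lim] order_tendstoD[OF \<sigma>_lim])
    moreover have "\<forall>\<^sub>F k in sequentially. k \<ge> 1" by (rule eventually_ge_at_top)
    ultimately have bounds: "\<forall>\<^sub>F k in sequentially. ereal (- ln (\<sigma> k) / ln (real d)) \<le> lower_local_dim (\<nu> k) x
        \<and> upper_local_dim (\<nu> k) x \<le> ereal (- ln (\<rho> k) / ln (real d))"
    proof eventually_elim
      case (elim k)
      interpret digit_measure "\<nu> k" d "k * m" "q k" using dm elim by blast
      have res: "\<bar>measure (q k) {b. b mod d = c mod d} - 1 / real d\<bar> \<le> err k" for c
        unfolding mod_eq_iff_dvd_add[OF d_pos] q_def err_def
        by (rule residue_equidistribution[OF d_pos fin \<eta>(2)])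
      have \<theta>M: "\<theta> * real (k * m) = k * e" using m by (simp add: \<theta>_def)
      have \<rho>: "\<rho> k \<le> measure (q k) {b. b mod d = c mod d \<and> \<bar>real b - \<theta> * real (k * m)\<bar> \<le> \<delta> * real (k * m)}" (is "_ \<le> measure _ ?B") for c
      proof -
        let ?T = "{b. \<delta> * real (k * m) \<le> \<bar>real b - k * e\<bar>}"
        \<comment> \<open>The residue class is covered by its part in the window and the tail
          \<open>?T\<close>, so restricting to the window loses at most \<open>tl k\<close>.\<close>
        have "measure (q k) {b. b mod d = c mod d} \<le> measure (q k) (?B \<union> ?T)"
          unfolding \<theta>M by (intro measure_pmf.finite_measure_mono) auto
        also have "\<dots> \<le> measure (q k) ?B + measure (q k) ?T"
          by (intro measure_Un_le) auto
        also have "measure (q k) ?T \<le> tl k"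
          unfolding q_def tl_def V_def using \<delta>(1) elim m
          by (intro order_trans[OF Chebyshev_digit_sum_1[OF fin e_def]]) auto
        finally show ?thesis using res[of c] unfolding \<rho>_def by linarith
      qed
      have \<sigma>: "measure (q k) {b. b mod d = c mod d} \<le> \<sigma> k" for c
        using res[of c] unfolding \<sigma>_def by linarith
      have "s \<le> \<delta>" using elim(1) by (simp add: s_def field_simps)
      then show ?case
        using interior_local_dim_bounds[of x \<delta> \<theta> "\<rho> k" "\<sigma> k"] x \<delta> elim \<rho> \<sigma> by auto
    qed
    have "(\<lambda>k. lower_local_dim (\<nu> k) x) \<longlonglongrightarrow> 1"
      by (rule tendsto_sandwich[OF _ _ to_1[OF \<sigma>_lim] to_1[OF \<rho>_lim]])
        (use bounds in \<open>eventually_elim, use lower_le_upper_local_dim order_trans in blast\<close>)+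
    moreover have "(\<lambda>k. upper_local_dim (\<nu> k) x) \<longlonglongrightarrow> 1"
      by (rule tendsto_sandwich[OF _ _ to_1[OF \<sigma>_lim] to_1[OF \<rho>_lim]])
        (use bounds in \<open>eventually_elim, use lower_le_upper_local_dim order_trans in blast\<close>)+
    ultimately show ?thesis by (simp add: local_dims_tendsto_def)
  qed
  ultimately show ?thesis unfolding \<nu>_def by blast
qed

end
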